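(* There exists a strongly polynomial-time algorithm for the weighted matroid intersection problem in the common independence oracle model when one of the matroids is an elementary split matroid. That is, if $\mathbf{M}_1=(E,\mathcal{I}_1)$ is an elementary split matroid (with unknown representation) and $\mathbf{M}_2=(E,\mathcal{I}_2)$ is an arbitrary matroid, then given $w\colon E\to\mathbb{R}$ there is an algorithm that, using only a common independence oracle, finds a set $I\in\mathcal{I}_1\cap\mathcal{I}_2$ maximizing $w(I)=\sum_{e\in I}w(e)$, with a number of oracle calls and elementary operations bounded by a polynomial in $n=|E|$.
   Context: Throughout, $\mathbf{M}_1=(E,\mathcal{I}_1)$ and $\mathbf{M}_2=(E,\mathcal{I}_2)$ are loopless matroids on a common finite ground set $E$ of size $n$. A common independence oracle, given $X\subseteq E$, answers ``Yes'' if $X\in\mathcal{I}_1\cap\mathcal{I}_2$ and ``No'' otherwise; the algorithm has no other access to the matroids. A matroid on $E$ is an elementary split matroid if there exist a nonnegative integer $r\le|E|$, a (possibly empty) collection $\mathcal{H}=\{H_1,\dots,H_q\}$ of subsets of $E$, and nonnegative integers $r_1,\dots,r_q$ with $|H_i\cap H_j|\le r_i+r_j-r$ for all $1\le i<j\le q$ and $|E\setminus H_i|+r_i\ge r$ for all $i$, such that its family of independent sets is $\{X\subseteq E : |X|\le r,\ |X\cap H_i|\le r_i \text{ for } 1\le i\le q\}$. *)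

theory Defs
  imports Complex_Main "HOL-Computational_Algebra.Polynomial"
begin

section \<open>Matroids\<close>

locale matroid =
  fixes E :: "'a set" and \<I> :: "'a set set"
  assumes finite_ground: "finite E"
    and indep_subset_ground: "X \<in> \<I> \<Longrightarrow> X \<subseteq> E"
    and indep_empty: "{} \<in> \<I>"
    and indep_subset: "Y \<in> \<I> \<Longrightarrow> X \<subseteq> Y \<Longrightarrow> X \<in> \<I>"
    and indep_augment:
      "X \<in> \<I> \<Longrightarrow> Y \<in> \<I> \<Longrightarrow> card X < card Y \<Longrightarrow> \<exists>y \<in> Y - X. insert y X \<in> \<I>"

definition loopless :: "'a set \<Rightarrow> 'a set set \<Rightarrow> bool" where
  "loopless E \<I> \<longleftrightarrow> (\<forall>x \<in> E. {x} \<in> \<I>)"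

text \<open>The hyperedges are indexed by \<open>i < q\<close>; the differences are taken in the integers.\<close>

definition elementary_split_matroid :: "'a set \<Rightarrow> 'a set set \<Rightarrow> bool" where
  "elementary_split_matroid E \<I> \<longleftrightarrow> matroid E \<I> \<and>
    (\<exists>(r::nat) (q::nat) (H :: nat \<Rightarrow> 'a set) (\<rho> :: nat \<Rightarrow> nat).
       r \<le> card E \<and>
       (\<forall>i<q. H i \<subseteq> E) \<and>
       (\<forall>i j. i < j \<and> j < q \<longrightarrow> int (card (H i \<inter> H j)) \<le> int (\<rho> i) + int (\<rho> j) - int r) \<and>
       (\<forall>i<q. card (E - H i) + \<rho> i \<ge> r) \<and>
       \<I> = {X. X \<subseteq> E \<and> card X \<le> r \<and> (\<forall>i<q. card (X \<inter> H i) \<le> \<rho> i)})"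

definition max_weight_common_indep ::
  "'a set set \<Rightarrow> 'a set set \<Rightarrow> ('a \<Rightarrow> real) \<Rightarrow> 'a set \<Rightarrow> bool" where
  "max_weight_common_indep \<I>1 \<I>2 w X \<longleftrightarrow>
     X \<in> \<I>1 \<inter> \<I>2 \<and> (\<forall>Y \<in> \<I>1 \<inter> \<I>2. (\<Sum>x\<in>Y. w x) \<le> (\<Sum>x\<in>X. w x))"

section \<open>Oracle programs\<close>

text \<open>
  A real random access machine in structured form, with an oracle for subsets of the natural
  numbers. The memory consists of arrays of natural numbers and arrays of reals; a scalar is an
  array used at index 0 only.

  The arithmetic is restricted so that counting operations is meaningful. Addition, truncated
  subtraction and comparison are the only operations on naturals, so that unit cost does not hide
  superpolynomial work on long integers (as unit-cost multiplication would). Reals can only be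
  added, subtracted and compared, and there is no conversion of reals to naturals; hence on
  rational inputs the bit length of every number that occurs is polynomial in the running time and
  the input length, as strongly polynomial time demands. Real constants are integers, so that a
  program cannot hide advice in a real constant.
\<close>

type_synonym vname = string

datatype nexp =
    NConst nat
  | NGet vname nexp
  | NPlus nexp nexp
  | NMinus nexp nexp

datatype rexp =
    RConst int
  | RGet vname nexp
  | RPlus rexp rexp
  | RMinus rexp rexp

datatype bexp =
    NLess nexp nexp
  | RLess rexp rexp
  | BNot bexp
  | BAnd bexp bexp

datatype com =
    Skip
  | NSet vname nexp nexp
  | RSet vname nexp rexp
  | Query vname vname
  | Seq com com
  | Cond bexp com com
  | While bexp com

record state =
  nats :: "vname \<Rightarrow> nat \<Rightarrow> nat"
  reals :: "vname \<Rightarrow> nat \<Rightarrow> real"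

fun nval :: "nexp \<Rightarrow> state \<Rightarrow> nat" where
  "nval (NConst k) s = k"
| "nval (NGet x a) s = nats s x (nval a s)"
| "nval (NPlus a b) s = nval a s + nval b s"
| "nval (NMinus a b) s = nval a s - nval b s"

fun rval :: "rexp \<Rightarrow> state \<Rightarrow> real" where
  "rval (RConst k) s = of_int k"
| "rval (RGet x a) s = reals s x (nval a s)"
| "rval (RPlus a b) s = rval a s + rval b s"
| "rval (RMinus a b) s = rval a s - rval b s"

fun bval :: "bexp \<Rightarrow> state \<Rightarrow> bool" where
  "bval (NLess a b) s \<longleftrightarrow> nval a s < nval b s"
| "bval (RLess a b) s \<longleftrightarrow> rval a s < rval b s"
| "bval (BNot b) s \<longleftrightarrow> \<not> bval b s"
| "bval (BAnd b c) s \<longleftrightarrow> bval b s \<and> bval c s"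

text \<open>Number of elementary operations (including memory accesses) in evaluating an expression.\<close>

fun ncost :: "nexp \<Rightarrow> nat" where
  "ncost (NConst k) = 1"
| "ncost (NGet x a) = ncost a + 1"
| "ncost (NPlus a b) = ncost a + ncost b + 1"
| "ncost (NMinus a b) = ncost a + ncost b + 1"

fun rcost :: "rexp \<Rightarrow> nat" where
  "rcost (RConst k) = 1"
| "rcost (RGet x a) = ncost a + 1"
| "rcost (RPlus a b) = rcost a + rcost b + 1"
| "rcost (RMinus a b) = rcost a + rcost b + 1"

fun bcost :: "bexp \<Rightarrow> nat" where
  "bcost (NLess a b) = ncost a + ncost b + 1"
| "bcost (RLess a b) = rcost a + rcost b + 1"
| "bcost (BNot b) = bcost b + 1"
| "bcost (BAnd b c) = bcost b + bcost c + 1"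

definition nset :: "vname \<Rightarrow> nat \<Rightarrow> nat \<Rightarrow> state \<Rightarrow> state" where
  "nset x i k s = s\<lparr>nats := (nats s)(x := (nats s x)(i := k))\<rparr>"

definition rset :: "vname \<Rightarrow> nat \<Rightarrow> real \<Rightarrow> state \<Rightarrow> state" where
  "rset x i v s = s\<lparr>reals := (reals s)(x := (reals s x)(i := v))\<rparr>"

text \<open>The set of which the array \<open>x\<close> is the characteristic vector.\<close>

definition array_set :: "state \<Rightarrow> vname \<Rightarrow> nat set" where
  "array_set s x = {i. nats s x i \<noteq> 0}"

text \<open>
  \<open>exec Q c s t s'\<close>: with oracle \<open>Q\<close>, program \<open>c\<close> started in \<open>s\<close> terminates in \<open>s'\<close>, and \<open>t\<close> is
  the number of elementary operations plus the number of oracle calls. \<open>Query x y\<close> asks the oracle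
  about the set stored in \<open>y\<close> and writes the answer to \<open>x\<close>.
\<close>

inductive exec :: "(nat set \<Rightarrow> bool) \<Rightarrow> com \<Rightarrow> state \<Rightarrow> nat \<Rightarrow> state \<Rightarrow> bool"
  for Q :: "nat set \<Rightarrow> bool" where
  exec_Skip: "exec Q Skip s 1 s"
| exec_NSet: "exec Q (NSet x a b) s (ncost a + ncost b + 1) (nset x (nval a s) (nval b s) s)"
| exec_RSet: "exec Q (RSet x a b) s (ncost a + rcost b + 1) (rset x (nval a s) (rval b s) s)"
| exec_Query: "exec Q (Query x y) s 1 (nset x 0 (if Q (array_set s y) then 1 else 0) s)"
| exec_Seq: "exec Q c1 s t1 s1 \<Longrightarrow> exec Q c2 s1 t2 s2 \<Longrightarrow> exec Q (Seq c1 c2) s (t1 + t2) s2"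
| exec_CondTrue: "bval b s \<Longrightarrow> exec Q c1 s t s' \<Longrightarrow> exec Q (Cond b c1 c2) s (bcost b + t) s'"
| exec_CondFalse: "\<not> bval b s \<Longrightarrow> exec Q c2 s t s' \<Longrightarrow> exec Q (Cond b c1 c2) s (bcost b + t) s'"
| exec_WhileFalse: "\<not> bval b s \<Longrightarrow> exec Q (While b c) s (bcost b) s"
| exec_WhileTrue: "bval b s \<Longrightarrow> exec Q c s t1 s1 \<Longrightarrow> exec Q (While b c) s1 t2 s2 \<Longrightarrow>
    exec Q (While b c) s (bcost b + t1 + t2) s2"

inductive_cases exec_SkipE: "exec Q Skip s t s'"
inductive_cases exec_NSetE: "exec Q (NSet x a b) s t s'"
inductive_cases exec_RSetE: "exec Q (RSet x a b) s t s'"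
inductive_cases exec_QueryE: "exec Q (Query x y) s t s'"
inductive_cases exec_SeqE: "exec Q (Seq c1 c2) s t s'"
inductive_cases exec_CondE: "exec Q (Cond b c1 c2) s t s'"
inductive_cases exec_WhileE: "exec Q (While b c) s t s'"

lemma exec_deterministic:
  "exec Q c s t s' \<Longrightarrow> exec Q c s u s'' \<Longrightarrow> u = t \<and> s'' = s'"
proof (induction arbitrary: u s'' rule: exec.induct)
  case exec_Skip then show ?case by (auto elim: exec_SkipE)
next
  case exec_NSet then show ?case by (auto elim: exec_NSetE)
next
  case exec_RSet then show ?case by (auto elim: exec_RSetE)
next
  case exec_Query then show ?case by (auto elim: exec_QueryE)
next
  case exec_Seq from exec_Seq.prems show ?case by (rule exec_SeqE) (use exec_Seq.IH in blast)
next
  case exec_CondTrue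
  from exec_CondTrue.prems show ?case by (rule exec_CondE) (use exec_CondTrue in blast)+
next
  case exec_CondFalse
  from exec_CondFalse.prems show ?case by (rule exec_CondE) (use exec_CondFalse in blast)+
next
  case exec_WhileFalse
  from exec_WhileFalse.prems show ?case by (rule exec_WhileE) (use exec_WhileFalse in blast)+
next
  case exec_WhileTrue
  from exec_WhileTrue.prems show ?case by (rule exec_WhileE) (use exec_WhileTrue in blast)+
qed

section \<open>The common independence oracle model\<close>

text \<open>
  The machine refers to the elements of the ground set by their positions in an enumeration
  \<open>e\<close> of it. A query that is not a set of positions is answered by \<open>False\<close>.
\<close>

definition common_indep_oracle ::
  "nat \<Rightarrow> (nat \<Rightarrow> 'a) \<Rightarrow> 'a set set \<Rightarrow> 'a set set \<Rightarrow> nat set \<Rightarrow> bool" where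
  "common_indep_oracle n e \<I>1 \<I>2 S \<longleftrightarrow> S \<subseteq> {..<n} \<and> e ` S \<in> \<I>1 \<inter> \<I>2"

definition input_state :: "nat \<Rightarrow> (nat \<Rightarrow> real) \<Rightarrow> state" where
  "input_state n v =
     \<lparr>nats = (\<lambda>x i. if x = ''n'' \<and> i = 0 then n else 0),
      reals = (\<lambda>x i. if x = ''w'' \<and> i < n then v i else 0)\<rparr>"

definition output_set :: "state \<Rightarrow> nat set" where
  "output_set s = array_set s ''out''"

end

theory Submission
  imports Defs
begin

text \<open>
  An independent set \<open>I\<close> of \<open>M\<^sub>1\<close> with \<open>card I < r\<close> has at most one tight hyperedge \<open>H\<close>, and every set of at
  most \<open>r\<close> elements that meets \<open>H\<close> in exactly \<open>\<rho>\<close> elements is independent. Hence all exchanges of \<open>M\<^sub>1\<close>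
  at \<open>I\<close> depend only on membership in \<open>H\<close>, and shortest augmenting paths, even weighted ones, have at
  most three vertices: if \<open>I\<close> has maximum weight among the common independent sets of size \<open>k\<close>, and
  one of size \<open>k + 1\<close> exists, then one of maximum weight has the form \<open>(I - {f}) \<union> {a, b}\<close>. Trying all
  triples \<open>(a, b, f)\<close> with the common independence oracle therefore yields an optimal set of every
  size, without any knowledge of the hyperedges.
\<close>

section \<open>Exchanges in matroids\<close>

context matroid begin

lemma finite_indep: "X \<in> \<I> \<Longrightarrow> finite X"
  using finite_ground indep_subset_ground finite_subset by blast

lemma indep_extend:
  assumes "X \<in> \<I>" "Y \<in> \<I>" "card X \<le> card Y"
  shows "\<exists>Z \<in> \<I>. X \<subseteq> Z \<and> Z \<subseteq> X \<union> Y \<and> card Z = card Y"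
  using assms
proof (induction "card Y - card X" arbitrary: X)
  case 0
  then show ?case by auto
next
  case (Suc d)
  then have less: "card X < card Y" by linarith
  then obtain y where y: "y \<in> Y - X" "insert y X \<in> \<I>"
    using indep_augment Suc.prems by blast
  have "card (insert y X) = Suc (card X)"
    using y(1) finite_indep[OF Suc.prems(1)] by simp
  moreover have "d = card Y - Suc (card X)" using Suc.hyps(2) by linarith
  ultimately obtain Z where "Z \<in> \<I>" "insert y X \<subseteq> Z" "Z \<subseteq> insert y X \<union> Y" "card Z = card Y"
    using Suc.hyps(1)[of "insert y X"] Suc.prems y(2) less by auto
  then show ?case using y(1) by blast
qed

text \<open>Symmetric basis exchange in the truncation of the matroid to rank \<open>card B\<close>.
  When \<open>insert e B\<close> is dependent, \<open>Z\<close> below is the fundamental circuit of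
  \<open>e\<close> without \<open>e\<close> itself. If no exchange worked,
  \<open>K = J - {e}\<close> would span \<open>Z\<close>, and \<open>insert e Z\<close> would come
  out independent.\<close>

lemma symmetric_exchange:
  assumes B: "B \<in> \<I>" and J: "J \<in> \<I>" and card_eq: "card B = card J" and e: "e \<in> J - B"
  shows "\<exists>f \<in> B - J. insert e (B - {f}) \<in> \<I> \<and> insert f (J - {e}) \<in> \<I>"
proof (cases "insert e B \<in> \<I>")
  case True
  have "J - {e} \<in> \<I>" using J indep_subset by blast
  moreover have "card (J - {e}) < card B"
    using e card_eq finite_indep[OF J] by (metis DiffD1 card_Diff1_less)
  ultimately obtain f where f: "f \<in> B - (J - {e})" "insert f (J - {e}) \<in> \<I>"
    using indep_augment B by blast
  then have "f \<in> B - J" using e by blast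
  moreover have "insert e (B - {f}) \<in> \<I>" using True by (rule indep_subset) blast
  ultimately show ?thesis using f(2) by blast
next
  case False
  define Z where "Z = {f \<in> B. insert e (B - {f}) \<in> \<I>}"
  define K where "K = J - {e}"
  have fJ: "finite J" and fB: "finite B" using B J finite_indep by auto
  have K: "K \<in> \<I>" unfolding K_def using J by (rule indep_subset) blast
  have cK: "Suc (card K) = card J"
    unfolding K_def using e fJ by (metis DiffD1 card.remove)
  have Z: "Z \<in> \<I>" unfolding Z_def using B by (rule indep_subset) blast
  show ?thesis
  proof (rule ccontr)
    assume "\<not> ?thesis"
    then have no: "insert f K \<notin> \<I>" if "f \<in> Z - K" for f
      using that e unfolding Z_def K_def by blast
    \<comment> \<open>No element of \<open>Z\<close> augments \<open>K\<close>, so \<open>K\<close>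
      has maximum size inside \<open>K \<union> Z\<close>.\<close>
    have max: "card X \<le> card K" if "X \<in> \<I>" "X \<subseteq> K \<union> Z" for X
    proof (rule ccontr)
      assume "\<not> card X \<le> card K"
      then obtain y where "y \<in> X - K" "insert y K \<in> \<I>"
        using indep_augment[OF K \<open>X \<in> \<I>\<close>] by auto
      then show False using no that(2) by blast
    qed
    then have "card Z \<le> card K" using Z by blast
    then obtain Y where Y: "Y \<in> \<I>" "Z \<subseteq> Y" "Y \<subseteq> Z \<union> K" "card Y = card K"
      using indep_extend[OF Z K] by blast
    then obtain y where y: "y \<in> J - Y" "insert y Y \<in> \<I>"
      using indep_augment[OF Y(1) J] cK by auto
    have "card (insert y Y) = Suc (card K)"
      using y(1) Y(4) finite_indep[OF Y(1)] by simp
    then have "\<not> insert y Y \<subseteq> K \<union> Z" using max[OF y(2)] by auto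
    \<comment> \<open>\<open>e\<close> is the only element of \<open>J\<close> outside
      \<open>K\<close>, so it must be the augmenting element.\<close>
    then have "y = e" using y(1) Y(3) unfolding K_def by blast
    then have eZ: "insert e Z \<in> \<I>" using y(2) Y(2) indep_subset by (meson insert_mono)
    have "card (insert e Z) \<le> Suc (card Z)" by (rule card_insert_le_m1) auto
    then have "card (insert e Z) \<le> card B" using \<open>card Z \<le> card K\<close> cK card_eq by linarith
    then obtain W where W: "W \<in> \<I>" "insert e Z \<subseteq> W" "W \<subseteq> insert e Z \<union> B" "card W = card B"
      using indep_extend[OF eZ B] by blast
    have WB: "W \<subseteq> insert e B" using W(3) unfolding Z_def by blast
    have "W \<noteq> insert e B" using False W(1) by blast
    then obtain f where f: "f \<in> B" "f \<notin> W" using WB W(2) by blast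
    \<comment> \<open>By cardinality \<open>W\<close> is the exchange of \<open>f\<close> for
      \<open>e\<close> in \<open>B\<close>. This puts \<open>f\<close> into \<open>Z\<close>,
      although \<open>Z \<subseteq> W\<close> and \<open>f\<close> is not in
      \<open>W\<close>.\<close>
    have "W \<subseteq> insert e (B - {f})" using WB f by blast
    moreover have "card (insert e (B - {f})) = card B"
      using f(1) e fB by (metis DiffD2 Diff_iff card_Suc_Diff1 card_insert_disjoint finite_Diff)
    ultimately have "W = insert e (B - {f})"
      using W(4) fB by (metis card_subset_eq finite_Diff finite_insert)
    then have "f \<in> Z" using W(1) f(1) unfolding Z_def by blast
    then show False using W(2) f(2) by blast
  qed
qed

text \<open>A perfect matching in the exchange graph of \<open>B\<close>. The induction moves
  \<open>J\<close> towards \<open>B\<close> by symmetric exchanges: one half of each exchange is an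
  arc of the fixed set \<open>B\<close>, the other half keeps the new \<open>J\<close>
  independent.\<close>

lemma exchange_bijection_bases:
  assumes "B \<in> \<I>" "J \<in> \<I>" "card B = card J"
  shows "\<exists>\<sigma>. bij_betw \<sigma> (J - B) (B - J) \<and> (\<forall>e \<in> J - B. insert e (B - {\<sigma> e}) \<in> \<I>)"
  using assms
proof (induction "card (J - B)" arbitrary: J)
  case 0
  have fin: "finite J" "finite B" using 0 finite_indep by auto
  then have "J \<subseteq> B" using 0 by auto
  then have "J = B" using 0 fin by (metis card_subset_eq)
  then show ?case by (simp add: bij_betw_def)
next
  case (Suc d)
  have fin: "finite J" "finite B" using Suc finite_indep by auto
  have "J - B \<noteq> {}" using Suc.hyps(2) by force
  then obtain e where e: "e \<in> J - B" by blast
  obtain f where f: "f \<in> B - J" "insert e (B - {f}) \<in> \<I>" "insert f (J - {e}) \<in> \<I>"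
    using symmetric_exchange[OF Suc.prems e] by blast
  let ?J = "insert f (J - {e})"
  have JB: "?J - B = (J - B) - {e}" and BJ: "B - ?J = (B - J) - {f}" using e f(1) by auto
  have "card (?J - B) = d" unfolding JB using Suc.hyps(2) e fin by simp
  moreover have "card ?J = card J"
    using e f(1) fin by (metis DiffD1 DiffD2 Diff_iff card_Suc_Diff1 card_insert_disjoint finite_Diff)
  ultimately obtain \<tau> where \<tau>: "bij_betw \<tau> (J - B - {e}) (B - J - {f})"
      "\<forall>x \<in> J - B - {e}. insert x (B - {\<tau> x}) \<in> \<I>"
    using Suc.hyps(1)[of ?J] Suc.prems f(3) unfolding JB BJ by auto
  have "bij_betw (\<tau>(e := f)) (J - B - {e}) (B - J - {f})"
    using \<tau>(1) by (subst bij_betw_cong[where g = \<tau>]) auto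
  then have "bij_betw (\<tau>(e := f)) (J - B - {e} \<union> {e}) (B - J - {f} \<union> {f})"
    using notIn_Un_bij_betw[of e "J - B - {e}" "\<tau>(e := f)" "B - J - {f}"] by simp
  then have "bij_betw (\<tau>(e := f)) (J - B) (B - J)"
    using e f(1) by (simp add: insert_absorb)
  then show ?case using \<tau>(2) f(2) by (intro exI[of _ "\<tau>(e := f)"]) auto
qed

text \<open>The matching is taken for \<open>insert j I\<close>, with \<open>j\<close> an augmenting
  element from \<open>J\<close>; dropping \<open>j\<close> again leaves exchanges of
  \<open>I\<close> itself.\<close>

lemma exchange_bijection_augment:
  assumes I: "I \<in> \<I>" and J: "J \<in> \<I>" and card_J: "card J = Suc (card I)"
  obtains j \<sigma> where "j \<in> J - I" "insert j I \<in> \<I>" "bij_betw \<sigma> (J - I - {j}) (I - J)"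
    "\<And>e. e \<in> J - I - {j} \<Longrightarrow> insert e (I - {\<sigma> e}) \<in> \<I>"
proof -
  obtain j where j: "j \<in> J - I" "insert j I \<in> \<I>"
    using indep_augment[OF I J] card_J by auto
  have "card (insert j I) = card J" using j(1) card_J finite_indep[OF I] by simp
  then obtain \<sigma> where \<sigma>: "bij_betw \<sigma> (J - insert j I) (insert j I - J)"
      "\<forall>e \<in> J - insert j I. insert e (insert j I - {\<sigma> e}) \<in> \<I>"
    using exchange_bijection_bases[OF j(2) J] by blast
  have "J - insert j I = J - I - {j}" "insert j I - J = I - J" using j(1) by auto
  moreover have "insert e (I - {\<sigma> e}) \<in> \<I>" if "e \<in> J - insert j I" for e
    using \<sigma>(2) that by (auto intro: indep_subset)
  ultimately show thesis using that j \<sigma>(1) by metis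
qed

text \<open>The unique-matching principle for two exchanges. Only \<open>e\<close> or
  \<open>f'\<close> can augment \<open>insert e' (I - {f, f'})\<close> from
  \<open>insert e (I - {f})\<close>, and \<open>f'\<close> would produce the excluded crossed
  exchange.\<close>

lemma exchange_two:
  assumes "insert e (I - {f}) \<in> \<I>" "insert e' (I - {f'}) \<in> \<I>" "insert e' (I - {f}) \<notin> \<I>"
    and "I \<in> \<I>" "f \<in> I" "f' \<in> I" "f \<noteq> f'" "e \<notin> I" "e' \<notin> I" "e \<noteq> e'"
  shows "insert e (insert e' (I - {f, f'})) \<in> \<I>"
proof -
  have fin: "finite I" using assms(4) finite_indep by blast
  have "insert e' (I - {f, f'}) \<in> \<I>" using assms(2) by (rule indep_subset) auto
  moreover have "card (I - {f, f'}) = card I - 2" "card I \<ge> 2"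
    using card_mono[of I "{f, f'}"] fin assms by (auto simp: card_Diff_subset)
  then have "card (insert e' (I - {f, f'})) < card (insert e (I - {f}))"
    using fin assms by simp
  ultimately obtain y where y: "y \<in> insert e (I - {f}) - insert e' (I - {f, f'})"
      "insert y (insert e' (I - {f, f'})) \<in> \<I>"
    using indep_augment assms(1) by blast
  then have "y = e \<or> y = f'" by blast
  moreover have "insert f' (insert e' (I - {f, f'})) = insert e' (I - {f})"
    using assms by blast
  ultimately show ?thesis using y(2) assms(3) by metis
qed

text \<open>The same argument with a source \<open>j\<close> in place of the second exchange: the
  candidates are \<open>j\<close> and \<open>f\<close>, and \<open>f\<close> would produce the
  dependent set \<open>insert e I\<close>.\<close>

lemma exchange_augment:
  assumes "insert j I \<in> \<I>" "insert e (I - {f}) \<in> \<I>" "insert e I \<notin> \<I>"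
    and "I \<in> \<I>" "f \<in> I" "j \<notin> I" "e \<notin> I"
  shows "insert j (insert e (I - {f})) \<in> \<I>"
proof -
  have fin: "finite I" using assms(4) finite_indep by blast
  then have "card (insert e (I - {f})) < card (insert j I)"
    using assms(5-7) by (simp add: card.remove[symmetric] del: card_Diff_insert)
  then obtain y where y: "y \<in> insert j I - insert e (I - {f})"
      "insert y (insert e (I - {f})) \<in> \<I>"
    using indep_augment assms(1,2) by blast
  then have "y = j \<or> y = f" by blast
  moreover have "insert f (insert e (I - {f})) = insert e I" using assms(5) by blast
  ultimately show ?thesis using y(2) assms(3) by metis
qed

end

section \<open>Augmentation in elementary split matroids\<close>

text \<open>The sum of \<open>card (X \<inter> H i)\<close> and \<open>card (X \<inter> H j)\<close>
  is at most \<open>card X + card (H i \<inter> H j)\<close>, hence at most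
  \<open>\<rho> i + \<rho> j\<close>. Equality at \<open>i\<close> therefore forces the bound at
  every other \<open>j\<close>.\<close>

lemma elementary_split_tight_indep:
  fixes H :: "nat \<Rightarrow> 'a set" and \<rho> :: "nat \<Rightarrow> nat"
  assumes "finite E"
    and inter: "\<And>i j. i < j \<Longrightarrow> j < q \<Longrightarrow> int (card (H i \<inter> H j)) \<le> int (\<rho> i) + int (\<rho> j) - int r"
    and HE: "\<And>i. i < q \<Longrightarrow> H i \<subseteq> E"
    and X: "X \<subseteq> E" "card X \<le> r" and i: "i < q" "card (X \<inter> H i) = \<rho> i"
    and j: "j < q"
  shows "card (X \<inter> H j) \<le> \<rho> j"
proof (cases "j = i")
  case False
  have fin: "finite X" "finite (H i)" using assms(1) X HE i finite_subset by blast+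
  have "int (card (H i \<inter> H j)) \<le> int (\<rho> i) + int (\<rho> j) - int r"
    using inter[of i j] inter[of j i] False i j by (cases "i < j") (auto simp: Int_commute)
  moreover have "card ((X \<inter> H i) \<inter> (X \<inter> H j)) \<le> card (H i \<inter> H j)"
    using fin by (intro card_mono) auto
  moreover have "card (X \<inter> H i) + card (X \<inter> H j) =
      card ((X \<inter> H i) \<union> (X \<inter> H j)) + card ((X \<inter> H i) \<inter> (X \<inter> H j))"
    using fin by (intro card_Un_Int) auto
  moreover have "card ((X \<inter> H i) \<union> (X \<inter> H j)) \<le> card X"
    using fin by (intro card_mono) auto
  ultimately show ?thesis using X i by linarith
qed (use i in simp)

text \<open>\<open>H\<close> is the unique tight hyperedge of \<open>I\<close> if there is one, and empty otherwise.\<close>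

lemma elementary_split_tight_set:
  assumes "elementary_split_matroid E \<I>" and I: "I \<in> \<I>" and J: "J \<in> \<I>" "card I < card J"
  obtains H where
    "\<And>e. e \<in> E - H \<Longrightarrow> insert e I \<in> \<I>"
    "\<And>X. X \<subseteq> E \<Longrightarrow> card X \<le> Suc (card I) \<Longrightarrow> X \<inter> H \<noteq> {} \<Longrightarrow> card (X \<inter> H) = card (I \<inter> H) \<Longrightarrow> X \<in> \<I>"
    "\<And>X. X \<in> \<I> \<Longrightarrow> card (X \<inter> H) \<le> card (I \<inter> H)"
proof -
  from assms(1) obtain r and q :: nat and H \<rho> where M: "matroid E \<I>"
    and "\<forall>i<q. H i \<subseteq> E"
    and "\<forall>i j. i < j \<and> j < q \<longrightarrow> int (card (H i \<inter> H j)) \<le> int (\<rho> i) + int (\<rho> j) - int r"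
    and \<I>: "\<I> = {X. X \<subseteq> E \<and> card X \<le> r \<and> (\<forall>i<q. card (X \<inter> H i) \<le> \<rho> i)}"
    unfolding elementary_split_matroid_def
    by (elim conjE exE) (rule that; assumption)
  then have HE: "\<And>i. i < q \<Longrightarrow> H i \<subseteq> E"
    and inter: "\<And>i j. i < j \<Longrightarrow> j < q \<Longrightarrow> int (card (H i \<inter> H j)) \<le> int (\<rho> i) + int (\<rho> j) - int r"
    by blast+
  interpret matroid E \<I> by (rule M)
  have fin: "finite I" using I finite_indep by blast
  \<comment> \<open>The larger set \<open>J\<close> shows that the bound \<open>r\<close> has room
    for one more element, so only hyperedges can obstruct an insertion.\<close>
  have r: "Suc (card I) \<le> r" using J \<I> by auto
  have IE: "I \<subseteq> E" using I indep_subset_ground by blast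
  show thesis
  proof (cases "\<exists>i<q. card (I \<inter> H i) = \<rho> i")
    case True
    then obtain i where i: "i < q" "card (I \<inter> H i) = \<rho> i" by blast
    have mem: "X \<in> \<I>" if "X \<subseteq> E" "card X \<le> Suc (card I)" "card (X \<inter> H i) = card (I \<inter> H i)" for X
      using elementary_split_tight_indep[OF finite_ground inter HE that(1) _ i(1)] that r i(2)
      unfolding \<I> by auto
    show thesis
    proof (rule that[of "H i"])
      show "insert e I \<in> \<I>" if "e \<in> E - H i" for e
        using that IE fin by (intro mem) (auto simp: card_insert_if)
      show "card (X \<inter> H i) \<le> card (I \<inter> H i)" if "X \<in> \<I>" for X
        using that i \<I> by auto
    qed (use mem in auto)
  next
    case False
    moreover have "card (I \<inter> H i) \<le> \<rho> i" if "i < q" for i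
      using I that by (simp add: \<I>)
    ultimately have less: "card (I \<inter> H i) < \<rho> i" if "i < q" for i
      using that le_neq_implies_less by blast
    show thesis
    \<comment> \<open>Without a tight hyperedge every insertion is possible. The guard
      \<open>X \<inter> H \<noteq> {}\<close> makes the second property vacuous for the empty
      set.\<close>
    proof (rule that[of "{}"])
      show "insert e I \<in> \<I>" if "e \<in> E - {}" for e
      proof -
        have "card (insert e I \<inter> H i) \<le> \<rho> i" if "i < q" for i
          using less[OF that] fin by (auto simp: Int_insert_left card_insert_if)
        then show ?thesis using that IE fin r unfolding \<I> by (auto simp: card_insert_if)
      qed
    qed auto
  qed
qed

text \<open>
  Exchange pairs \<open>(e, \<sigma> e)\<close> entering \<open>H\<close> are paired with exchange pairs leaving \<open>H\<close>. For two such
  pairs, either the double exchange or both crossed single exchanges keep common independence.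
\<close>

lemma local_augmentation:
  fixes w :: "'a \<Rightarrow> real"
  assumes split: "elementary_split_matroid E \<I>1" and M2: "matroid E \<I>2"
    and I: "I \<in> \<I>1 \<inter> \<I>2" and J: "J \<in> \<I>1 \<inter> \<I>2" and card_J: "card J = Suc (card I)"
    and opt: "\<And>X. X \<in> \<I>1 \<inter> \<I>2 \<Longrightarrow> card X = card I \<Longrightarrow> sum w X \<le> sum w I"
  shows "\<exists>a \<in> E. \<exists>b \<in> E. \<exists>f \<in> E. (I - {f}) \<union> {a, b} \<in> \<I>1 \<inter> \<I>2 \<and>
    card ((I - {f}) \<union> {a, b}) = Suc (card I) \<and> sum w J \<le> sum w ((I - {f}) \<union> {a, b})"
proof -
  interpret M1: matroid E \<I>1 using split unfolding elementary_split_matroid_def by blast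
  interpret M2: matroid E \<I>2 by (rule M2)
  have IE: "I \<subseteq> E" and JE: "J \<subseteq> E" and fin: "finite I" "finite J"
    using I J M1.indep_subset_ground M1.finite_indep by auto
  obtain H where
    free: "\<And>e. e \<in> E - H \<Longrightarrow> insert e I \<in> \<I>1" and
    tight: "\<And>X. X \<subseteq> E \<Longrightarrow> card X \<le> Suc (card I) \<Longrightarrow> X \<inter> H \<noteq> {} \<Longrightarrow> card (X \<inter> H) = card (I \<inter> H) \<Longrightarrow> X \<in> \<I>1" and
    le: "\<And>X. X \<in> \<I>1 \<Longrightarrow> card (X \<inter> H) \<le> card (I \<inter> H)"
    using elementary_split_tight_set[OF split, of I J] I J card_J by auto
  obtain j \<sigma> where j: "j \<in> J - I" "insert j I \<in> \<I>2" and \<sigma>: "bij_betw \<sigma> (J - I - {j}) (I - J)"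
    and arc: "\<And>e. e \<in> J - I - {j} \<Longrightarrow> insert e (I - {\<sigma> e}) \<in> \<I>2"
    using M2.exchange_bijection_augment[of I J] I J card_J by auto
  \<comment> \<open>\<open>j\<close> is a source of the exchange graph of the second matroid, and
    \<open>\<sigma>\<close> matches \<open>P\<close> with the elements of \<open>I\<close> that are
    not in \<open>J\<close>.\<close>
  define P where "P = J - I - {j}"
  have \<sigma>P: "\<sigma> e \<in> I - J" if "e \<in> P" for e using \<sigma> that unfolding P_def bij_betw_def by blast
  have arcP: "insert e (I - {\<sigma> e}) \<in> \<I>2" if "e \<in> P" for e using arc that unfolding P_def by blast
  have inj: "inj_on \<sigma> P" using \<sigma> unfolding P_def bij_betw_def by blast
  have fP: "finite P" unfolding P_def using fin by simp
  have P: "e \<in> E" "e \<notin> I" if "e \<in> P" for e using that JE unfolding P_def by auto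
  have sum_swap: "sum w (insert e (I - {f})) = sum w I + w e - w f"
    and card_swap: "card (insert e (I - {f})) = card I" if "e \<notin> I" "f \<in> I" for e f
    using that fin by (simp_all add: sum_diff1 card.remove[symmetric] del: card_Diff_insert)
  \<comment> \<open>In the first matroid an exchange can fail only by raising the count in
    \<open>H\<close>: with both ends in \<open>H\<close> the count is unchanged, and an
    \<open>e\<close> outside \<open>H\<close> may be inserted freely.\<close>
  have swap1: "insert e (I - {f}) \<in> \<I>1" if "e \<in> E - I" "f \<in> I" "e \<in> H \<longrightarrow> f \<in> H" for e f
  proof (cases "e \<in> H")
    case True
    have "insert e (I - {f}) \<inter> H = insert e ((I \<inter> H) - {f})" using True by blast
    also have "card \<dots> = card (I \<inter> H)"
      using that True fin by (simp add: card.remove[symmetric] del: card_Diff_insert)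
    finally show ?thesis
      using that IE True card_swap[of e f] by (intro tight) auto
  next
    case False
    then have "insert e I \<in> \<I>1" using free that by blast
    then show ?thesis by (rule M1.indep_subset) blast
  qed
  have swap: "w e \<le> w f" if "e \<in> E - I" "f \<in> I" "e \<in> H \<longrightarrow> f \<in> H" "insert e (I - {f}) \<in> \<I>2" for e f
    using opt[of "insert e (I - {f})"] swap1[OF that(1-3)] that sum_swap[of e f] card_swap[of e f] by auto
  have swap2: "w e + w e' \<le> w (\<sigma> e) + w (\<sigma> e')"
    if "e \<in> P" "e' \<in> P" "e \<in> H" "\<sigma> e \<notin> H" "e' \<notin> H" "\<sigma> e' \<in> H" for e e'
  proof (cases "insert e' (I - {\<sigma> e}) \<in> \<I>2 \<and> insert e (I - {\<sigma> e'}) \<in> \<I>2")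
    case True
    then have "w e' \<le> w (\<sigma> e)" "w e \<le> w (\<sigma> e')"
      using that P \<sigma>P by (auto intro!: swap)
    then show ?thesis by simp
  next
    case False
    let ?X = "insert e (insert e' (I - {\<sigma> e, \<sigma> e'}))"
    have ne: "e \<noteq> e'" "\<sigma> e \<noteq> \<sigma> e'" using that by auto
    have mem: "\<sigma> e \<in> I" "\<sigma> e' \<in> I" "e \<notin> I" "e' \<notin> I" using that(1,2) P \<sigma>P by auto
    have arcs: "insert e (I - {\<sigma> e}) \<in> \<I>2" "insert e' (I - {\<sigma> e'}) \<in> \<I>2"
      using that(1,2) arcP by auto
    have X2: "?X \<in> \<I>2"
      using False M2.exchange_two[OF arcs] M2.exchange_two[OF arcs(2,1)] ne mem I
      by (auto simp: insert_commute)
    have dec: "I - {\<sigma> e, \<sigma> e'} = I - {\<sigma> e} - {\<sigma> e'}" by blast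
    have card_X: "card ?X = card I"
    proof -
      have "card I = Suc (Suc (card (I - {\<sigma> e} - {\<sigma> e'})))"
        using mem ne fin by (metis Diff_iff card_Suc_Diff1 finite_Diff singletonD)
      then show ?thesis unfolding dec using mem ne fin by simp
    qed
    have sum_X: "sum w ?X = sum w I + w e + w e' - w (\<sigma> e) - w (\<sigma> e')"
      unfolding dec using mem ne fin by (simp add: sum_diff1)
    have "?X \<inter> H = insert e ((I \<inter> H) - {\<sigma> e'})" using that(3-6) by auto
    also have "card \<dots> = card (I \<inter> H)"
      using that mem fin by (simp add: card.remove[symmetric] del: card_Diff_insert)
    finally have "?X \<in> \<I>1" using card_X that P IE by (intro tight) auto
    then show ?thesis using opt[of ?X] X2 card_X sum_X by auto
  qed
  \<comment> \<open>\<open>B\<close> holds the bad pairs, which raise the count in \<open>H\<close>;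
    \<open>G\<close> holds the good pairs, which lower it and can compensate.\<close>
  define B where "B = {e \<in> P. e \<in> H \<and> \<sigma> e \<notin> H}"
  define G where "G = {e \<in> P. e \<notin> H \<and> \<sigma> e \<in> H}"
  have fBG: "finite B" "finite G" unfolding B_def G_def using fP by auto
  define g where "g e = w e - w (\<sigma> e)" for e
  have g_le: "g e \<le> 0" if "e \<in> P - B" for e
    unfolding g_def using swap[of e "\<sigma> e"] that P \<sigma>P arcP unfolding B_def by auto
  \<comment> \<open>Bad pairs are matched injectively with good pairs in \<open>D\<close> and
    bounded by \<open>swap2\<close>; each remaining pair has nonpositive gain by itself.\<close>
  have gain: "sum g D \<le> 0" if D: "D \<subseteq> P" "B \<subseteq> D" "card B \<le> card (G \<inter> D)" for D
  proof -
    obtain \<iota> where \<iota>: "\<iota> ` B \<subseteq> G \<inter> D" "inj_on \<iota> B"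
      using card_le_inj[OF fBG(1) _ D(3)] fBG by auto
    have fD: "finite D" using D fP finite_subset by blast
    have disj: "B \<inter> \<iota> ` B = {}" using \<iota>(1) unfolding B_def G_def by blast
    have "sum g D = sum g (B \<union> \<iota> ` B) + sum g (D - (B \<union> \<iota> ` B))"
      using fD D \<iota> by (subst sum.subset_diff[of "B \<union> \<iota> ` B"]) auto
    also have "sum g (B \<union> \<iota> ` B) = (\<Sum>e\<in>B. g e + g (\<iota> e))"
      using disj fBG \<iota> by (simp add: sum.union_disjoint sum.reindex sum.distrib)
    also have "\<dots> \<le> 0"
    proof (rule sum_nonpos)
      fix e assume "e \<in> B"
      then have "\<iota> e \<in> G" using \<iota> by blast
      then show "g e + g (\<iota> e) \<le> 0"
        using swap2[of e "\<iota> e"] \<open>e \<in> B\<close> unfolding B_def G_def g_def by auto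
    qed
    also have "sum g (D - (B \<union> \<iota> ` B)) \<le> 0"
      using D by (intro sum_nonpos g_le) auto
    finally show ?thesis by simp
  qed
  have sum_J: "sum w J = sum w I + w j + sum g P"
  proof -
    have "sum w J = sum w (J \<inter> I) + (w j + sum w P)"
    proof -
      have "J = (J \<inter> I) \<union> insert j P" "(J \<inter> I) \<inter> insert j P = {}" "j \<notin> P"
        using j unfolding P_def by auto
      then show ?thesis using fin fP by (metis finite_Int finite_insert sum.insert sum.union_disjoint)
    qed
    moreover have "sum w I = sum w (J \<inter> I) + sum w (I - J)"
      using fin by (metis Int_commute sum.Int_Diff)
    moreover have "sum w (I - J) = (\<Sum>e\<in>P. w (\<sigma> e))"
      using sum.reindex_bij_betw[OF \<sigma>] unfolding P_def by metis
    ultimately show ?thesis unfolding g_def by (simp add: sum_subtractf)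
  qed
  \<comment> \<open>This is \<open>card (J \<inter> H) \<le> card (I \<inter> H)\<close> counted
    along \<open>\<sigma>\<close>: common elements and pairs with both ends in \<open>H\<close>
    cancel.\<close>
  have balance: "card B + (if j \<in> H then 1 else 0) \<le> card G"
  proof -
    let ?A = "{e \<in> P. e \<in> H \<and> \<sigma> e \<in> H}"
    have "card (J \<inter> H) = card (J \<inter> I \<inter> H) + card ((J - I) \<inter> H)"
      using fin by (subst card_Un_disjoint[symmetric]) (auto intro!: arg_cong[where f = card])
    moreover have "card (I \<inter> H) = card (J \<inter> I \<inter> H) + card ((I - J) \<inter> H)"
      using fin by (subst card_Un_disjoint[symmetric]) (auto intro!: arg_cong[where f = card])
    moreover have "card ((J - I) \<inter> H) = card (P \<inter> H) + (if j \<in> H then 1 else 0)"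
    proof -
      have "(J - I) \<inter> H = (if j \<in> H then insert j (P \<inter> H) else P \<inter> H)" "j \<notin> P"
        using j unfolding P_def by auto
      then show ?thesis using fP by simp
    qed
    moreover have "card (P \<inter> H) = card ?A + card B"
      using fP fBG unfolding B_def
      by (subst card_Un_disjoint[symmetric]) (auto intro!: arg_cong[where f = card])
    moreover have "card ((I - J) \<inter> H) = card ?A + card G"
    proof -
      have "(I - J) \<inter> H = \<sigma> ` (?A \<union> G)"
      proof -
        have "I - J = \<sigma> ` P" using \<sigma> unfolding P_def bij_betw_def by simp
        then show ?thesis unfolding G_def by auto
      qed
      moreover have "inj_on \<sigma> (?A \<union> G)" using inj unfolding G_def by (auto intro: inj_on_subset)
      ultimately have "card ((I - J) \<inter> H) = card (?A \<union> G)" by (simp add: card_image)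
      also have "\<dots> = card ?A + card G"
        using fP fBG by (intro card_Un_disjoint) (auto simp: G_def)
      finally show ?thesis .
    qed
    ultimately show ?thesis using le[of J] J by auto
  qed
  \<comment> \<open>A plain insertion is the degenerate triple in which all three elements are
    \<open>a\<close>.\<close>
  have single: ?thesis if "a \<in> E - I" "insert a I \<in> \<I>1 \<inter> \<I>2" "sum w J \<le> sum w I + w a" for a
  proof -
    have "(I - {a}) \<union> {a, a} = insert a I" using that(1) by blast
    moreover have "card (insert a I) = Suc (card I)" "sum w (insert a I) = sum w I + w a"
      using that(1) fin by auto
    ultimately show ?thesis using that by (metis DiffD1)
  qed
  have jE: "j \<in> E - I" using j JE by blast
  show ?thesis
  proof (cases "j \<in> H")
    case False
    \<comment> \<open>There are enough good pairs to offset all bad ones, so discarding every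
      exchange loses nothing and \<open>insert j I\<close> is at least as heavy as
      \<open>J\<close>.\<close>
    have "sum g P \<le> 0"
      using balance False by (intro gain) (auto simp: B_def G_def Int_absorb2)
    then show ?thesis
      using single[OF jE] sum_J free[of j] False jE j(2) by auto
  next
    case True
    \<comment> \<open>Since \<open>j\<close> itself occupies a place in \<open>H\<close>, there are
      more good pairs than bad ones. One good pair \<open>(e, f)\<close> is reserved for
      \<open>j\<close>; the others still offset \<open>B\<close>.\<close>
    then have "G \<noteq> {}" using balance by auto
    then obtain e where e: "e \<in> G" by blast
    define f where "f = \<sigma> e"
    have eP: "e \<in> P" "e \<notin> H" "e \<in> E - I" "f \<in> H" "f \<in> I"
      using e P \<sigma>P unfolding G_def f_def by auto
    have ef: "insert e (I - {f}) \<in> \<I>2" using arcP eP(1) unfolding f_def by blast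
    have "e \<noteq> j" using eP(1) unfolding P_def by blast
    have "card (G \<inter> (P - {e})) = card G - 1"
    proof -
      have "G \<inter> (P - {e}) = G - {e}" unfolding G_def by blast
      then show ?thesis using e by simp
    qed
    then have "sum g (P - {e}) \<le> 0"
      using balance True e by (intro gain) (auto simp: B_def G_def)
    moreover have "sum g P = g e + sum g (P - {e})"
      using sum.remove[OF fP eP(1)] by blast
    ultimately have J_le: "sum w J \<le> sum w I + w j + w e - w f"
      using sum_J unfolding g_def f_def by linarith
    show ?thesis
    proof (cases "insert e I \<in> \<I>2")
      case True
      have "insert j (I - {f}) \<in> \<I>2" using j(2) by (rule M2.indep_subset) auto
      then have "w j \<le> w f" using jE eP by (intro swap) auto
      then show ?thesis using single[of e] free[of e] True eP J_le by auto
    next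
      case False
      let ?X = "(I - {f}) \<union> {j, e}"
      have X: "?X = insert j (insert e (I - {f}))" by blast
      have X2: "?X \<in> \<I>2"
        unfolding X using M2.exchange_augment[OF j(2) ef False] I eP jE by auto
      have cX: "card ?X = Suc (card I)"
        unfolding X using card_swap[of e f] eP jE fin \<open>e \<noteq> j\<close> by simp
      have sX: "sum w ?X = sum w I + w j + w e - w f"
        unfolding X using sum_swap[of e f] eP jE fin \<open>e \<noteq> j\<close> by simp
      \<comment> \<open>\<open>j\<close> enters \<open>H\<close> while \<open>f\<close> leaves it,
        so the count is unchanged and \<open>tight\<close> applies.\<close>
      have "?X \<inter> H = insert j ((I \<inter> H) - {f})" using \<open>j \<in> H\<close> eP(2) by auto
      also have "card \<dots> = card (I \<inter> H)"
        using jE eP fin by (simp add: card.remove[symmetric] del: card_Diff_insert)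
      finally have "?X \<in> \<I>1" using cX jE eP IE \<open>j \<in> H\<close> by (intro tight) auto
      then have "?X \<in> \<I>1 \<inter> \<I>2 \<and> card ?X = Suc (card I) \<and> sum w J \<le> sum w ?X"
        using X2 cX sX J_le by simp
      moreover have "j \<in> E" "e \<in> E" "f \<in> E" using jE eP(3,5) IE by auto
      ultimately show ?thesis by (intro bexI)
    qed
  qed
qed

section \<open>Timed execution of programs\<close>

text \<open>Total correctness with a time bound. \<open>R\<close> may again be a \<open>runs\<close>
  statement, as in \<open>runs_Seq\<close>, so the rules act like a weakest-precondition
  calculus.\<close>

definition runs :: "(nat set \<Rightarrow> bool) \<Rightarrow> com \<Rightarrow> state \<Rightarrow> nat \<Rightarrow> (state \<Rightarrow> bool) \<Rightarrow> bool" where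
  "runs Q c s T R \<longleftrightarrow> (\<exists>t s'. exec Q c s t s' \<and> t \<le> T \<and> R s')"

lemma runs_mono: "runs Q c s T R \<Longrightarrow> T \<le> T' \<Longrightarrow> (\<And>s'. R s' \<Longrightarrow> R' s') \<Longrightarrow> runs Q c s T' R'"
  unfolding runs_def by (meson le_trans)

lemma runs_Skip: "R s \<Longrightarrow> runs Q Skip s 1 R"
  unfolding runs_def using exec_Skip by blast

lemma runs_NSet: "R (nset x (nval a s) (nval b s) s) \<Longrightarrow> ncost a + ncost b + 1 \<le> T \<Longrightarrow>
    runs Q (NSet x a b) s T R"
  unfolding runs_def using exec_NSet by blast

lemma runs_RSet: "R (rset x (nval a s) (rval b s) s) \<Longrightarrow> ncost a + rcost b + 1 \<le> T \<Longrightarrow>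
    runs Q (RSet x a b) s T R"
  unfolding runs_def using exec_RSet by blast

lemma runs_Query: "R (nset x 0 (if Q (array_set s y) then 1 else 0) s) \<Longrightarrow> runs Q (Query x y) s 1 R"
  unfolding runs_def using exec_Query by blast

lemma runs_Seq: "runs Q c1 s T1 (\<lambda>s'. runs Q c2 s' T2 R) \<Longrightarrow> runs Q (Seq c1 c2) s (T1 + T2) R"
  unfolding runs_def by (meson add_mono exec_Seq)

lemma runs_Cond:
  assumes "bval b s \<Longrightarrow> runs Q c1 s T1 R" "\<not> bval b s \<Longrightarrow> runs Q c2 s T2 R"
    and "bcost b + max T1 T2 \<le> T"
  shows "runs Q (Cond b c1 c2) s T R"
proof (cases "bval b s")
  case True
  then obtain t s' where "exec Q c1 s t s'" "t \<le> T1" "R s'"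
    using assms(1) unfolding runs_def by blast
  then show ?thesis
    unfolding runs_def using exec_CondTrue[OF True] assms(3) by fastforce
next
  case False
  then obtain t s' where "exec Q c2 s t s'" "t \<le> T2" "R s'"
    using assms(2) unfolding runs_def by blast
  then show ?thesis
    unfolding runs_def using exec_CondFalse[OF False] assms(3) by fastforce
qed

section \<open>Counted loops, frame conditions and array copying\<close>

abbreviation scalar :: "vname \<Rightarrow> nexp" where
  "scalar x \<equiv> NGet x (NConst 0)"

definition for_loop :: "vname \<Rightarrow> com \<Rightarrow> com" where
  "for_loop x c = Seq (NSet x (NConst 0) (NConst 0))
     (While (NLess (scalar x) (scalar ''n''))
        (Seq c (NSet x (NConst 0) (NPlus (scalar x) (NConst 1)))))"

text \<open>Each iteration adds 5 for the test and 6 for the increment; initialization and the final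
  failing test cost 3 + 5. As \<open>Inv\<close> fixes the value of the counter, the step asserts it
  for the state after the increment.\<close>

lemma runs_for_loop:
  assumes inv: "\<And>i s. Inv i s \<Longrightarrow> nats s ''n'' 0 = n \<and> nats s x 0 = i"
    and init: "Inv 0 (nset x 0 0 s)"
    and step: "\<And>i s. i < n \<Longrightarrow> Inv i s \<Longrightarrow>
      runs Q c s T (\<lambda>s'. nats s' x 0 = i \<and> Inv (Suc i) (nset x 0 (Suc i) s'))"
  shows "runs Q (for_loop x c) s (n * (T + 11) + 8) (Inv n)"
proof -
  let ?b = "NLess (scalar x) (scalar ''n'')"
  let ?c = "Seq c (NSet x (NConst 0) (NPlus (scalar x) (NConst 1)))"
  have loop: "runs Q (While ?b ?c) s (d * (T + 11) + 5) (Inv n)" if "Inv i s" "i + d = n" for d i s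
    using that
  proof (induction d arbitrary: i s)
    case 0
    then have "\<not> bval ?b s" using inv by fastforce
    then show ?case using exec_WhileFalse[of ?b s Q ?c] 0 unfolding runs_def by fastforce
  next
    case (Suc d)
    have b: "bval ?b s" using inv[OF Suc.prems(1)] Suc.prems(2) by simp
    have "runs Q ?c s (T + 6) (Inv (Suc i))"
      by (rule runs_Seq, rule runs_mono[OF step[OF _ Suc.prems(1)]])
        (use Suc.prems(2) in \<open>auto intro!: runs_NSet\<close>)
    then obtain t1 s1 where 1: "exec Q ?c s t1 s1" "t1 \<le> T + 6" "Inv (Suc i) s1"
      unfolding runs_def by blast
    then obtain t2 s2 where 2: "exec Q (While ?b ?c) s1 t2 s2" "t2 \<le> d * (T + 11) + 5" "Inv n s2"
      using Suc.IH[OF 1(3)] Suc.prems(2) unfolding runs_def by auto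
    show ?case
      unfolding runs_def using exec_WhileTrue[OF b 1(1) 2(1)] 1(2) 2(2,3)
      by (intro exI conjI) auto
  qed
  have "runs Q (for_loop x c) s (3 + (n * (T + 11) + 5)) (Inv n)"
    unfolding for_loop_def
    by (rule runs_Seq, rule runs_NSet, unfold nval.simps, rule loop[OF init]) simp_all
  then show ?thesis by (simp add: add.commute add.left_commute)
qed

text \<open>A frame condition: \<open>N\<close> and \<open>R\<close> list the natural and real
  arrays that a program may have changed.\<close>

definition agree_off :: "vname set \<Rightarrow> vname set \<Rightarrow> state \<Rightarrow> state \<Rightarrow> bool" where
  "agree_off N R s s' \<longleftrightarrow>
     (\<forall>x. x \<notin> N \<longrightarrow> nats s' x = nats s x) \<and> (\<forall>x. x \<notin> R \<longrightarrow> reals s' x = reals s x)"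

lemma agree_off_trans:
  assumes "agree_off N R s s1" "agree_off N' R' s1 s2" "N \<union> N' \<subseteq> M" "R \<union> R' \<subseteq> L"
  shows "agree_off M L s s2"
  using assms unfolding agree_off_def by (metis UnCI subsetD)

lemma agree_off_mono: "agree_off N R s s' \<Longrightarrow> N \<subseteq> M \<Longrightarrow> R \<subseteq> L \<Longrightarrow> agree_off M L s s'"
  unfolding agree_off_def by blast

lemma nats_nset [simp]: "nats (nset x i k s) = (nats s)(x := (nats s x)(i := k))"
  and reals_nset [simp]: "reals (nset x i k s) = reals s"
  and nats_rset [simp]: "nats (rset x i v s) = nats s"
  and reals_rset [simp]: "reals (rset x i v s) = (reals s)(x := (reals s x)(i := v))"
  by (simp_all add: nset_def rset_def)

lemma agree_off_nset: "x \<in> N \<Longrightarrow> agree_off N R s (nset x i k s') \<longleftrightarrow> agree_off N R s s'"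
  unfolding agree_off_def by (metis fun_upd_other nats_nset reals_nset)

lemma agree_off_array_set: "agree_off N R s s' \<Longrightarrow> x \<notin> N \<Longrightarrow> array_set s' x = array_set s x"
  by (simp add: array_set_def agree_off_def)

lemma array_set_nset:
  "array_set (nset x i k s) y =
    (if y = x then (if k = 0 then array_set s x - {i} else insert i (array_set s x)) else array_set s y)"
  by (auto simp: array_set_def)

lemma array_set_rset [simp]: "array_set (rset x i v s) y = array_set s y"
  by (simp add: array_set_def)

definition copy_array :: "vname \<Rightarrow> vname \<Rightarrow> com" where
  "copy_array x y = for_loop ''i'' (NSet x (scalar ''i'') (NGet y (scalar ''i'')))"

lemma runs_copy_array:
  assumes "nats s ''n'' 0 = n" "array_set s x \<subseteq> {..<n}" "array_set s y \<subseteq> {..<n}"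
    and "x \<notin> {''n'', ''i''}" "y \<notin> {''n'', ''i''}" "x \<noteq> y"
  shows "runs Q (copy_array x y) s (17 * n + 8)
    (\<lambda>s'. agree_off {''i'', x} {} s s' \<and> array_set s' x = array_set s y)"
proof -
  define Inv where "Inv i s' \<longleftrightarrow> agree_off {''i'', x} {} s s' \<and> nats s' ''i'' 0 = i \<and>
    (\<forall>m. nats s' x m = (if m < i then nats s y m else nats s x m))" for i s'
  have "runs Q (copy_array x y) s (n * (6 + 11) + 8) (Inv n)"
    unfolding copy_array_def
  proof (rule runs_for_loop)
    show "Inv 0 (nset ''i'' 0 0 s)" using assms by (simp add: Inv_def agree_off_def)
    show "nats s' ''n'' 0 = n \<and> nats s' ''i'' 0 = i" if "Inv i s'" for i s'
      using that assms by (auto simp: Inv_def agree_off_def)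
    show "runs Q (NSet x (scalar ''i'') (NGet y (scalar ''i''))) s' 6
        (\<lambda>s'. nats s' ''i'' 0 = i \<and> Inv (Suc i) (nset ''i'' 0 (Suc i) s'))"
      if "i < n" "Inv i s'" for i s'
      by (rule runs_NSet)
        (use that assms in \<open>auto simp: Inv_def agree_off_def less_Suc_eq\<close>)
  qed
  \<comment> \<open>Only the first \<open>n\<close> cells are copied; beyond them both arrays were
    zero from the start.\<close>
  moreover have "array_set s' x = array_set s y" if "Inv n s'" for s'
    using that assms unfolding Inv_def array_set_def by (auto split: if_splits)
  ultimately show ?thesis
    by (elim runs_mono) (auto simp: Inv_def)
qed

section \<open>The local search program\<close>

definition measure_trial :: com where
  "measure_trial =
     Seq (NSet ''size'' (NConst 0) (NConst 0))
    (Seq (RSet ''wt'' (NConst 0) (RConst 0))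
       (for_loop ''i'' (Cond (NLess (NConst 0) (NGet ''T'' (scalar ''i'')))
          (Seq (NSet ''size'' (NConst 0) (NPlus (scalar ''size'') (NConst 1)))
               (RSet ''wt'' (NConst 0) (RPlus (RGet ''wt'' (NConst 0)) (RGet ''w'' (scalar ''i'')))))
          Skip)))"

lemma runs_measure_trial:
  assumes "nats s ''n'' 0 = n" "array_set s ''T'' \<subseteq> {..<n}"
  shows "runs Q measure_trial s (31 * n + 14)
    (\<lambda>s'. agree_off {''i'', ''size''} {''wt''} s s' \<and> nats s' ''size'' 0 = card (array_set s ''T'') \<and>
      reals s' ''wt'' 0 = sum (reals s ''w'') (array_set s ''T''))"
proof -
  define A where "A = array_set s ''T''"
  have A: "nats s ''T'' i > 0 \<longleftrightarrow> i \<in> A" for i by (simp add: A_def array_set_def)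
  have AS: "A \<inter> {..<Suc i} = (if i \<in> A then insert i (A \<inter> {..<i}) else A \<inter> {..<i})" for i
    by (auto simp: less_Suc_eq)
  define Inv where "Inv i s' \<longleftrightarrow> agree_off {''i'', ''size''} {''wt''} s s' \<and> nats s' ''i'' 0 = i \<and>
    nats s' ''size'' 0 = card (A \<inter> {..<i}) \<and>
    reals s' ''wt'' 0 = sum (reals s ''w'') (A \<inter> {..<i})" for i s'
  have "runs Q measure_trial s (3 + (3 + (n * (20 + 11) + 8))) (Inv n)"
    unfolding measure_trial_def
  proof (rule runs_Seq, rule runs_NSet, rule runs_Seq, rule runs_RSet, rule runs_for_loop)
    show "nats s' ''n'' 0 = n \<and> nats s' ''i'' 0 = i" if "Inv i s'" for i s'
      using that assms by (auto simp: Inv_def agree_off_def)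
  next
    fix i s' assume i: "i < n" and Inv: "Inv i s'"
    show "runs Q (Cond (NLess (NConst 0) (NGet ''T'' (scalar ''i'')))
          (Seq (NSet ''size'' (NConst 0) (NPlus (scalar ''size'') (NConst 1)))
               (RSet ''wt'' (NConst 0) (RPlus (RGet ''wt'' (NConst 0)) (RGet ''w'' (scalar ''i'')))))
          Skip) s' 20 (\<lambda>s'. nats s' ''i'' 0 = i \<and> Inv (Suc i) (nset ''i'' 0 (Suc i) s'))"
      (is "runs _ _ _ _ ?R")
    proof (rule runs_Cond)
      show "runs Q (Seq (NSet ''size'' (NConst 0) (NPlus (scalar ''size'') (NConst 1)))
               (RSet ''wt'' (NConst 0) (RPlus (RGet ''wt'' (NConst 0)) (RGet ''w'' (scalar ''i'')))))
          s' (6 + 8) ?R" if "bval (NLess (NConst 0) (NGet ''T'' (scalar ''i''))) s'"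
        by (rule runs_Seq, rule runs_NSet, rule runs_RSet)
          (use that Inv A[of i] AS[of i] in \<open>auto simp: Inv_def agree_off_def\<close>)
      show "runs Q Skip s' 1 ?R" if "\<not> bval (NLess (NConst 0) (NGet ''T'' (scalar ''i''))) s'"
        by (rule runs_Skip) (use that Inv A[of i] AS[of i] in \<open>auto simp: Inv_def agree_off_def\<close>)
    qed simp
  qed (auto simp: Inv_def agree_off_def)
  moreover have "A \<inter> {..<n} = A" using assms by (auto simp: A_def)
  ultimately show ?thesis
    by (elim runs_mono) (auto simp: Inv_def A_def)
qed

text \<open>Equality of \<open>size\<close> and \<open>k + 1\<close> is expressed by two negated
  comparisons. The flag \<open>found\<close> replaces an initial best weight of minus infinity: the
  first feasible candidate is always accepted, later ones only if strictly heavier.\<close>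

definition improves :: bexp where
  "improves = BAnd (NLess (NConst 0) (scalar ''q''))
     (BAnd (BNot (NLess (scalar ''size'') (NPlus (scalar ''k'') (NConst 1))))
     (BAnd (BNot (NLess (NPlus (scalar ''k'') (NConst 1)) (scalar ''size'')))
           (BNot (BAnd (NLess (NConst 0) (scalar ''found''))
                       (BNot (RLess (RGet ''bw'' (NConst 0)) (RGet ''wt'' (NConst 0))))))))"

definition update_best :: com where
  "update_best = Cond improves
     (Seq (copy_array ''best'' ''T'')
     (Seq (NSet ''found'' (NConst 0) (NConst 1))
          (RSet ''bw'' (NConst 0) (RGet ''wt'' (NConst 0)))))
     Skip"

text \<open>Deletion precedes both insertions, so \<open>f\<close> survives if it equals
  \<open>a\<close> or \<open>b\<close>, in agreement with \<open>exchange\<close>.\<close>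

definition try_exchange :: com where
  "try_exchange =
     Seq (copy_array ''T'' ''cur'')
    (Seq (NSet ''T'' (scalar ''f'') (NConst 0))
    (Seq (NSet ''T'' (scalar ''a'') (NConst 1))
    (Seq (NSet ''T'' (scalar ''b'') (NConst 1))
    (Seq (Query ''q'' ''T'')
    (Seq measure_trial update_best)))))"

text \<open>The invariant of the search: \<open>D\<close> is the family of candidates tried so
  far.\<close>

definition best_of :: "(nat set \<Rightarrow> bool) \<Rightarrow> (nat \<Rightarrow> real) \<Rightarrow> nat \<Rightarrow> nat set set \<Rightarrow> state \<Rightarrow> bool" where
  "best_of Q v k D s \<longleftrightarrow>
    (if nats s ''found'' 0 = 0 then \<forall>X \<in> D. \<not> (Q X \<and> card X = k)
     else array_set s ''best'' \<in> D \<and> Q (array_set s ''best'') \<and> card (array_set s ''best'') = k \<and>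
       reals s ''bw'' 0 = sum v (array_set s ''best'') \<and>
       (\<forall>X \<in> D. Q X \<and> card X = k \<longrightarrow> sum v X \<le> reals s ''bw'' 0))"

definition search_inv :: "nat \<Rightarrow> state \<Rightarrow> bool" where
  "search_inv n s \<longleftrightarrow> nats s ''n'' 0 = n \<and> array_set s ''T'' \<subseteq> {..<n} \<and>
     array_set s ''cur'' \<subseteq> {..<n} \<and> array_set s ''best'' \<subseteq> {..<n}"

abbreviation search_nats :: "vname set" where
  "search_nats \<equiv> {''i'', ''T'', ''q'', ''size'', ''best'', ''found''}"

abbreviation search_reals :: "vname set" where
  "search_reals \<equiv> {''wt'', ''bw''}"

definition exchange :: "nat set \<Rightarrow> nat \<Rightarrow> nat \<Rightarrow> nat \<Rightarrow> nat set" where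
  "exchange I a b f = (I - {f}) \<union> {a, b}"

lemma runs_try_exchange:
  assumes s: "search_inv n s" "nats s ''k'' 0 = k" "reals s ''w'' = v" "array_set s ''cur'' = I"
      "nats s ''a'' 0 = a" "nats s ''b'' 0 = b" "nats s ''f'' 0 = f" "a < n" "b < n" "f < n"
    and best: "best_of Q v (Suc k) D s"
  shows "runs Q try_exchange s (100 * n + 100)
    (\<lambda>s'. agree_off search_nats search_reals s s' \<and> search_inv n s' \<and>
      best_of Q v (Suc k) (insert (exchange I a b f) D) s')"
proof -
  let ?X = "exchange I a b f"
  let ?R = "\<lambda>s'. agree_off search_nats search_reals s s' \<and> search_inv n s' \<and>
      best_of Q v (Suc k) (insert ?X D) s'"
  note inv = s(1)[unfolded search_inv_def]
  have X: "?X \<subseteq> {..<n}" using s inv by (auto simp: exchange_def)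
  have "runs Q try_exchange s
      ((17 * n + 8) + (4 + (4 + (4 + (1 + ((31 * n + 14) + (17 * n + 60))))))) ?R"
    unfolding try_exchange_def
  proof (rule runs_Seq, rule runs_mono[OF runs_copy_array[where n = n] order_refl])
    fix s1
    assume 1: "agree_off {''i'', ''T''} {} s s1 \<and> array_set s1 ''T'' = array_set s ''cur''"
    let ?sa = "nset ''T'' (nval (scalar ''f'') s1) (nval (NConst 0) s1) s1"
    let ?sb = "nset ''T'' (nval (scalar ''a'') ?sa) (nval (NConst 1) ?sa) ?sa"
    let ?s2 = "nset ''T'' (nval (scalar ''b'') ?sb) (nval (NConst 1) ?sb) ?sb"
    let ?s3 = "nset ''q'' 0 (if Q (array_set ?s2 ''T'') then 1 else 0) ?s2"
    have T2: "array_set ?s2 ''T'' = ?X"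
      using 1 s by (auto simp: array_set_nset exchange_def agree_off_def)
    have T3: "array_set ?s3 ''T'' = ?X"
      using T2 by (simp add: array_set_nset)
    have ag3: "agree_off {''i'', ''T'', ''q''} {} s ?s3"
      using 1 by (auto simp: agree_off_def)
    have q3: "nats ?s3 ''q'' 0 = (if Q ?X then 1 else 0)"
      using T2 by simp
    have n3: "nats ?s3 ''n'' 0 = n" using ag3 inv by (auto simp: agree_off_def)
    have T3n: "array_set ?s3 ''T'' \<subseteq> {..<n}" using T3 X by simp
    have update: "runs Q update_best s4 (17 * n + 60) ?R" if "agree_off {''i'', ''size''} {''wt''} ?s3 s4 \<and>
      nats s4 ''size'' 0 = card (array_set ?s3 ''T'') \<and>
      reals s4 ''wt'' 0 = sum (reals ?s3 ''w'') (array_set ?s3 ''T'')" for s4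
    proof -
      from that have ag34: "agree_off {''i'', ''size''} {''wt''} ?s3 s4"
        and size4: "nats s4 ''size'' 0 = card ?X" and wt4: "reals s4 ''wt'' 0 = sum v ?X"
        using T3 ag3 s by (auto simp: agree_off_def)
      have ag4: "agree_off {''i'', ''T'', ''q'', ''size''} {''wt''} s s4"
        using ag3 ag34 by (rule agree_off_trans) auto
      have q4: "nats s4 ''q'' 0 = (if Q ?X then 1 else 0)"
        using ag34 q3 unfolding agree_off_def by auto
      have T4: "array_set s4 ''T'' = ?X"
        using agree_off_array_set[OF ag34, of "''T''"] T3 by simp
      have s4: "nats s4 ''n'' = nats s ''n''" "nats s4 ''k'' 0 = k" "nats s4 ''found'' = nats s ''found''"
        "reals s4 ''bw'' = reals s ''bw''" "array_set s4 ''best'' = array_set s ''best''"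
        "array_set s4 ''cur'' = array_set s ''cur''"
        using ag4 s(2) by (simp_all add: agree_off_def array_set_def)
      show "runs Q update_best s4 (17 * n + 60) ?R"
        unfolding update_best_def
      proof (rule runs_Cond)
        have c: "bval improves s4 \<longleftrightarrow> Q ?X \<and> card ?X = Suc k \<and>
            \<not> (nats s ''found'' 0 > 0 \<and> \<not> reals s ''bw'' 0 < sum v ?X)"
          by (simp add: improves_def q4 size4 wt4 s4) linarith
        {
          assume "\<not> bval improves s4"
          then have rejected: "\<not> (Q ?X \<and> card ?X = Suc k \<and>
              \<not> (nats s ''found'' 0 > 0 \<and> \<not> reals s ''bw'' 0 < sum v ?X))"
            unfolding c .
          have "?R s4"
          proof (intro conjI)
            show "agree_off search_nats search_reals s s4"
              using ag4 by (rule agree_off_mono) auto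
            show "search_inv n s4"
              using inv s4 T4 X by (simp add: search_inv_def)
            show "best_of Q v (Suc k) (insert ?X D) s4"
              using rejected best unfolding best_of_def s4 by (cases "nats s ''found'' 0 = 0") auto
          qed
          then show "runs Q Skip s4 1 ?R" by (rule runs_Skip)
        }
        assume "bval improves s4"
        then have ok: "Q ?X" "card ?X = Suc k" "nats s ''found'' 0 > 0 \<Longrightarrow> reals s ''bw'' 0 < sum v ?X"
          unfolding c by blast+
        show "runs Q (Seq (copy_array ''best'' ''T'')
           (Seq (NSet ''found'' (NConst 0) (NConst 1))
              (RSet ''bw'' (NConst 0) (RGet ''wt'' (NConst 0))))) s4 ((17 * n + 8) + (3 + 4)) ?R"
        proof (rule runs_Seq, rule runs_mono[OF runs_copy_array order_refl])
          show "nats s4 ''n'' 0 = n" "array_set s4 ''best'' \<subseteq> {..<n}"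
            using s4 inv by simp_all
          fix s5 assume 5: "agree_off {''i'', ''best''} {} s4 s5 \<and>
            array_set s5 ''best'' = array_set s4 ''T''"
          let ?s6 = "rset ''bw'' 0 (sum v ?X) (nset ''found'' 0 1 s5)"
          have b6: "array_set ?s6 ''best'' = ?X" using 5 T4 by (simp add: array_set_nset)
          have "agree_off search_nats search_reals s ?s6"
          proof -
            have "agree_off {''i'', ''best'', ''found''} {''bw''} s4 ?s6"
              using 5 by (simp add: agree_off_def)
            with ag4 show ?thesis by (rule agree_off_trans) auto
          qed
          moreover have "search_inv n ?s6"
          proof -
            have "array_set s5 ''T'' = ?X" "array_set s5 ''cur'' = array_set s ''cur''" "nats s5 ''n'' 0 = n"
              using 5 T4 s4 inv by (simp_all add: agree_off_def array_set_def)
            then show ?thesis using b6 X inv by (simp add: search_inv_def array_set_nset)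
          qed
          moreover have "best_of Q v (Suc k) (insert ?X D) ?s6"
          proof -
            \<comment> \<open>Either no earlier candidate was feasible, or all feasible ones are
              bounded by the old \<open>bw\<close>, which the new weight exceeds.\<close>
            have "sum v Y \<le> sum v ?X" if "Y \<in> D" "Q Y" "card Y = Suc k" for Y
              using best that ok(3) unfolding best_of_def by (fastforce split: if_splits)
            then show ?thesis using b6 ok by (auto simp: best_of_def)
          qed
          moreover have "reals s5 ''wt'' 0 = sum v ?X" using 5 wt4 by (simp add: agree_off_def)
          ultimately have "?R (rset ''bw'' 0 (reals s5 ''wt'' 0) (nset ''found'' 0 1 s5))" by simp
          then show "runs Q (Seq (NSet ''found'' (NConst 0) (NConst 1))
              (RSet ''bw'' (NConst 0) (RGet ''wt'' (NConst 0)))) s5 (3 + 4) ?R"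
            by (intro runs_Seq runs_NSet runs_RSet) auto
        qed (use T4 X in auto)
      qed (simp add: improves_def)
    qed
    show "runs Q
       (Seq (NSet ''T'' (scalar ''f'') (NConst 0))
       (Seq (NSet ''T'' (scalar ''a'') (NConst 1))
       (Seq (NSet ''T'' (scalar ''b'') (NConst 1))
       (Seq (Query ''q'' ''T'')
       (Seq measure_trial update_best))))) s1 (4 + (4 + (4 + (1 + ((31 * n + 14) + (17 * n + 60)))))) ?R"
      by (rule runs_Seq, rule runs_NSet, rule runs_Seq, rule runs_NSet, rule runs_Seq, rule runs_NSet,
          rule runs_Seq, rule runs_Query, rule runs_Seq,
          rule runs_mono[OF runs_measure_trial[OF n3 T3n] order_refl], rule update) simp_all
  qed (use inv in auto)
  then show ?thesis by (rule runs_mono) auto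
qed

section \<open>Exhaustive search over all triples\<close>

definition search :: com where
  "search = for_loop ''a'' (for_loop ''b'' (for_loop ''f'' try_exchange))"

lemma runs_search:
  assumes s: "search_inv n s" "nats s ''k'' 0 = k" "reals s ''w'' = v" "array_set s ''cur'' = I"
    and found: "nats s ''found'' 0 = 0"
  shows "runs Q search s (n * (n * (n * (100 * n + 111) + 19) + 19) + 8)
    (\<lambda>s'. agree_off (search_nats \<union> {''a'', ''b'', ''f''}) search_reals s s' \<and> search_inv n s' \<and>
      best_of Q v (Suc k) {exchange I a b f | a b f. a < n \<and> b < n \<and> f < n} s')"
proof -
  \<comment> \<open>One invariant serves all three loops: it is insensitive to their counters, and
    only \<open>D\<close> grows. Each inner loop is proved for an arbitrary starting
    \<open>D\<close>.\<close>
  define ctx where "ctx D s' \<longleftrightarrow> agree_off (search_nats \<union> {''a'', ''b'', ''f''}) search_reals s s' \<and>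
    search_inv n s' \<and> best_of Q v (Suc k) D s'" for D s'
  have ctx_nset: "ctx D (nset x 0 m s') \<longleftrightarrow> ctx D s'"
    if "x \<in> {''a'', ''b'', ''f''}" for D x m s'
  proof -
    have "search_inv n (nset x 0 m s') \<longleftrightarrow> search_inv n s'"
      using that by (auto simp: search_inv_def array_set_nset)
    moreover have "best_of Q v (Suc k) D (nset x 0 m s') \<longleftrightarrow> best_of Q v (Suc k) D s'"
      using that by (auto simp: best_of_def array_set_nset)
    moreover have "x \<in> search_nats \<union> {''a'', ''b'', ''f''}" using that by blast
    ultimately show ?thesis by (simp only: ctx_def agree_off_nset)
  qed
  have ctx_n: "nats s' ''n'' 0 = n" if "ctx D s'" for D s'
    using that by (auto simp: ctx_def search_inv_def)
  have f_loop: "runs Q (for_loop ''f'' try_exchange) s' (n * ((100 * n + 100) + 11) + 8)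
      (\<lambda>s''. ctx (D \<union> {exchange I a b f | f. f < n}) s'' \<and> nats s'' ''a'' 0 = a \<and> nats s'' ''b'' 0 = b)"
    if "ctx D s'" "nats s' ''a'' 0 = a" "nats s' ''b'' 0 = b" "a < n" "b < n" for D a b s'
  proof (rule runs_mono[OF runs_for_loop[where n = n and
        Inv = "\<lambda>i s''. ctx (D \<union> {exchange I a b f | f. f < i}) s'' \<and>
          nats s'' ''a'' 0 = a \<and> nats s'' ''b'' 0 = b \<and> nats s'' ''f'' 0 = i"] order_refl], goal_cases)
    case (3 i s1)
    have "{exchange I a b f | f. f < Suc i} = insert (exchange I a b i) {exchange I a b f | f. f < i}"
      by (auto simp: less_Suc_eq)
    then have D: "D \<union> {exchange I a b f | f. f < Suc i} =
        insert (exchange I a b i) (D \<union> {exchange I a b f | f. f < i})" by simp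
    have s1: "search_inv n s1" "nats s1 ''k'' 0 = k" "reals s1 ''w'' = v" "array_set s1 ''cur'' = I"
      "best_of Q v (Suc k) (D \<union> {exchange I a b f | f. f < i}) s1"
      using 3 s by (auto simp: ctx_def agree_off_def array_set_def)
    show ?case
    proof (rule runs_mono[OF runs_try_exchange[OF s1(1-4) _ _ _ _ _ _ s1(5)] order_refl])
      fix s2 assume 2: "agree_off search_nats search_reals s1 s2 \<and> search_inv n s2 \<and>
        best_of Q v (Suc k) (insert (exchange I a b i) (D \<union> {exchange I a b f |f. f < i})) s2"
      moreover have "agree_off (search_nats \<union> {''a'', ''b'', ''f''}) search_reals s s2"
      proof (rule agree_off_trans)
        show "agree_off (search_nats \<union> {''a'', ''b'', ''f''}) search_reals s s1"
          using 3(2) unfolding ctx_def by (elim conjE)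
        show "agree_off search_nats search_reals s1 s2" using 2 by (elim conjE)
      qed simp_all
      ultimately have "ctx (D \<union> {exchange I a b f | f. f < Suc i}) s2"
        unfolding ctx_def D by (intro conjI; elim conjE)
      moreover have "nats s2 ''a'' = nats s1 ''a''" "nats s2 ''b'' = nats s1 ''b''" "nats s2 ''f'' = nats s1 ''f''"
        using 2 by (simp_all add: agree_off_def)
      ultimately show "nats s2 ''f'' 0 = i \<and> ctx (D \<union> {exchange I a b f |f. f < Suc i}) (nset ''f'' 0 (Suc i) s2) \<and>
        nats (nset ''f'' 0 (Suc i) s2) ''a'' 0 = a \<and> nats (nset ''f'' 0 (Suc i) s2) ''b'' 0 = b \<and>
        nats (nset ''f'' 0 (Suc i) s2) ''f'' 0 = Suc i"
        using 3(2) by (simp add: ctx_nset)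
    qed (use 3 that in auto)
  qed (use that ctx_n ctx_nset in auto)
  have b_loop: "runs Q (for_loop ''b'' (for_loop ''f'' try_exchange)) s'
        (n * ((n * ((100 * n + 100) + 11) + 8) + 11) + 8)
      (\<lambda>s''. ctx (D \<union> {exchange I a b f | b f. b < n \<and> f < n}) s'' \<and> nats s'' ''a'' 0 = a)"
    if "ctx D s'" "nats s' ''a'' 0 = a" "a < n" for D a s'
  proof (rule runs_mono[OF runs_for_loop[where n = n and
        Inv = "\<lambda>i s''. ctx (D \<union> {exchange I a b f | b f. b < i \<and> f < n}) s'' \<and>
          nats s'' ''a'' 0 = a \<and> nats s'' ''b'' 0 = i"] order_refl], goal_cases)
    case (3 i s1)
    have D: "D \<union> {exchange I a b f | b f. b < Suc i \<and> f < n} =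
        (D \<union> {exchange I a b f | b f. b < i \<and> f < n}) \<union> {exchange I a i f | f. f < n}"
      by (auto simp: less_Suc_eq)
    show ?case
      unfolding D
      by (rule runs_mono[OF f_loop[where a = a and b = i] order_refl]) (use 3 that ctx_nset in auto)
  qed (use that ctx_n ctx_nset in auto)
  have "ctx {} s" using s found by (auto simp: ctx_def agree_off_def best_of_def)
  then have "runs Q search s (n * ((n * ((n * ((100 * n + 100) + 11) + 8) + 11) + 8) + 11) + 8)
      (\<lambda>s''. ctx {exchange I a b f | a b f. a < n \<and> b < n \<and> f < n} s'')"
    unfolding search_def
  proof (rule_tac runs_mono[OF runs_for_loop[where n = n and
        Inv = "\<lambda>i s''. ctx {exchange I a b f | a b f. a < i \<and> b < n \<and> f < n} s'' \<and>
          nats s'' ''a'' 0 = i"] order_refl], goal_cases)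
    case (3 i s1)
    have D: "{exchange I a b f | a b f. a < Suc i \<and> b < n \<and> f < n} =
        {exchange I a b f | a b f. a < i \<and> b < n \<and> f < n} \<union> {exchange I i b f | b f. b < n \<and> f < n}"
      by (auto simp: less_Suc_eq)
    show ?case
      unfolding D
      by (rule runs_mono[OF b_loop[where a = i] order_refl]) (use 3 ctx_nset in auto)
  qed (use ctx_n ctx_nset in auto)
  then show ?thesis
    by (rule runs_mono) (auto simp: ctx_def algebra_simps)
qed

section \<open>The outer loop over cardinalities\<close>

definition update_output :: com where
  "update_output = Cond (RLess (RGet ''ow'' (NConst 0)) (RGet ''bw'' (NConst 0)))
     (Seq (copy_array ''out'' ''best'')
          (RSet ''ow'' (NConst 0) (RGet ''bw'' (NConst 0))))
     Skip"

definition commit_best :: com where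
  "commit_best = Cond (NLess (NConst 0) (scalar ''found''))
     (Seq (copy_array ''cur'' ''best'') update_output)
     Skip"

definition greedy_step :: com where
  "greedy_step =
     Seq (NSet ''found'' (NConst 0) (NConst 0))
    (Seq search commit_best)"

definition opt_of_card :: "(nat set \<Rightarrow> bool) \<Rightarrow> (nat \<Rightarrow> real) \<Rightarrow> nat \<Rightarrow> nat set \<Rightarrow> bool" where
  "opt_of_card Q v k X \<longleftrightarrow> Q X \<and> card X = k \<and> (\<forall>Y. Q Y \<longrightarrow> card Y = k \<longrightarrow> sum v Y \<le> sum v X)"

text \<open>Weights may be negative, so \<open>out\<close> records the best set of any size up to
  \<open>k\<close>, apart from \<open>cur\<close>. The claim on \<open>cur\<close> is conditional
  because \<open>cur\<close> goes stale once no feasible set of size \<open>k\<close>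
  exists.\<close>

definition greedy_inv :: "(nat set \<Rightarrow> bool) \<Rightarrow> (nat \<Rightarrow> real) \<Rightarrow> nat \<Rightarrow> nat \<Rightarrow> state \<Rightarrow> bool" where
  "greedy_inv Q v n k s \<longleftrightarrow> search_inv n s \<and> nats s ''k'' 0 = k \<and> reals s ''w'' = v \<and>
     array_set s ''out'' \<subseteq> {..<n} \<and> Q (array_set s ''out'') \<and>
     reals s ''ow'' 0 = sum v (array_set s ''out'') \<and>
     (\<forall>Y. Q Y \<longrightarrow> card Y \<le> k \<longrightarrow> sum v Y \<le> reals s ''ow'' 0) \<and>
     ((\<exists>Y. Q Y \<and> card Y = k) \<longrightarrow> opt_of_card Q v k (array_set s ''cur''))"

text \<open>Matroids enter only through \<open>down\<close> and \<open>augment\<close>; the latter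
  is \<open>local_augmentation\<close> in terms of positions.\<close>

lemma runs_greedy_step:
  assumes down: "\<And>X Y. Q Y \<Longrightarrow> X \<subseteq> Y \<Longrightarrow> Q X"
    and augment: "\<And>k I J. opt_of_card Q v k I \<Longrightarrow> Q J \<Longrightarrow> card J = Suc k \<Longrightarrow>
      \<exists>a<n. \<exists>b<n. \<exists>f<n. Q (exchange I a b f) \<and> card (exchange I a b f) = Suc k \<and>
        sum v J \<le> sum v (exchange I a b f)"
    and inv: "greedy_inv Q v n k s"
  shows "runs Q greedy_step s (n * (n * (n * (100 * n + 111) + 19) + 19) + 100 * n + 100)
    (\<lambda>s'. nats s' ''k'' 0 = k \<and> greedy_inv Q v n (Suc k) (nset ''k'' 0 (Suc k) s'))"
proof -
  let ?R = "\<lambda>s'. nats s' ''k'' 0 = k \<and> greedy_inv Q v n (Suc k) (nset ''k'' 0 (Suc k) s')"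
  define I where "I = array_set s ''cur''"
  define D where "D = {exchange I a b f | a b f. a < n \<and> b < n \<and> f < n}"
  let ?s0 = "nset ''found'' 0 0 s"
  note inv' = inv[unfolded greedy_inv_def search_inv_def]
  \<comment> \<open>Shrinking \<open>J\<close> gives a feasible set of size \<open>k\<close>, which
    triggers the conditional clause of the invariant.\<close>
  have Ik: "opt_of_card Q v k I" if J: "Q J" "card J = Suc k" for J
  proof -
    obtain X where "X \<subseteq> J" "card X = k" using J(2) by (metis obtain_subset_with_card_n le_SucI order_refl)
    then show ?thesis using inv' J(1) down unfolding I_def by blast
  qed
  have s0: "search_inv n ?s0" "nats ?s0 ''k'' 0 = k" "reals ?s0 ''w'' = v" "array_set ?s0 ''cur'' = I"
    "nats ?s0 ''found'' 0 = 0"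
    using inv' by (auto simp: search_inv_def array_set_nset I_def)
  have "runs Q greedy_step s (3 + ((n * (n * (n * (100 * n + 111) + 19) + 19) + 8) + (60 + 34 * n))) ?R"
    unfolding greedy_step_def
  proof (rule runs_Seq, rule runs_NSet, rule runs_Seq)
    show "runs Q search (nset ''found'' (nval (NConst 0) s) (nval (NConst 0) s) s)
      (n * (n * (n * (100 * n + 111) + 19) + 19) + 8)
      (\<lambda>s'. runs Q commit_best s' (60 + 34 * n) ?R)"
      unfolding nval.simps
    proof (rule runs_mono[OF runs_search[OF s0] order_refl])
      fix s1
      assume "agree_off (search_nats \<union> {''a'', ''b'', ''f''}) search_reals ?s0 s1 \<and> search_inv n s1 \<and>
        best_of Q v (Suc k) {exchange I a b f | a b f. a < n \<and> b < n \<and> f < n} s1"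
      then have ag: "agree_off (search_nats \<union> {''a'', ''b'', ''f''}) search_reals s s1"
        and si: "search_inv n s1" and best: "best_of Q v (Suc k) D s1"
        unfolding D_def by (auto simp: agree_off_def)
      have s1: "nats s1 ''k'' 0 = k" "reals s1 ''w'' = v" "array_set s1 ''out'' = array_set s ''out''"
        "reals s1 ''ow'' = reals s ''ow''"
        using ag inv' by (auto simp: agree_off_def array_set_def)
      show "runs Q commit_best s1 (60 + 34 * n) ?R"
        unfolding commit_best_def
      proof (rule runs_Cond)
        assume "\<not> bval (NLess (NConst 0) (scalar ''found'')) s1"
        then have none: "\<not> (Q X \<and> card X = Suc k)" if "X \<in> D" for X
          using best that by (auto simp: best_of_def)
        \<comment> \<open>A feasible \<open>J\<close> of the next size would, by
          \<open>augment\<close>, yield a feasible candidate in \<open>D\<close>. Hence the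
          invariant carries over with \<open>cur\<close> and \<open>out\<close> unchanged.\<close>
        have no: "\<not> (Q J \<and> card J = Suc k)" for J
          using augment[OF Ik] none unfolding D_def by blast
        have "?R s1"
          using inv' s1 si no by (auto simp: greedy_inv_def search_inv_def array_set_nset le_Suc_eq)
        then show "runs Q Skip s1 1 ?R" by (rule runs_Skip)
      next
        assume "bval (NLess (NConst 0) (scalar ''found'')) s1"
        moreover define X where "X = array_set s1 ''best''"
        ultimately have X: "Q X" "card X = Suc k" "reals s1 ''bw'' 0 = sum v X"
          and Xmax: "\<And>Y. Y \<in> D \<Longrightarrow> Q Y \<Longrightarrow> card Y = Suc k \<Longrightarrow> sum v Y \<le> sum v X"
          using best by (auto simp: best_of_def)
        \<comment> \<open>Some candidate in \<open>D\<close> is at least as heavy as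
          \<open>J\<close>, so the best of \<open>D\<close> is optimal among all feasible sets of
          this size.\<close>
        have max: "sum v J \<le> sum v X" if "Q J" "card J = Suc k" for J
          using augment[OF Ik[OF that] that] Xmax order_trans unfolding D_def by blast
        then have opt: "opt_of_card Q v (Suc k) X" using X by (auto simp: opt_of_card_def)
        show "runs Q (Seq (copy_array ''cur'' ''best'') update_output) s1 ((17 * n + 8) + (5 + ((17 * n + 8 + 4) + 1))) ?R"
        proof (rule runs_Seq, rule runs_mono[OF runs_copy_array[where n = n] order_refl])
          fix s2 assume 2: "agree_off {''i'', ''cur''} {} s1 s2 \<and>
            array_set s2 ''cur'' = array_set s1 ''best''"
          have s2: "search_inv n s2" "nats s2 ''k'' 0 = k" "reals s2 ''w'' = v"
            "array_set s2 ''out'' = array_set s ''out''" "reals s2 ''ow'' = reals s ''ow''"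
            "reals s2 ''bw'' 0 = sum v X" "array_set s2 ''cur'' = X" "array_set s2 ''best'' = X"
            using 2 s1 si X by (auto simp: agree_off_def search_inv_def X_def array_set_def)
          show "runs Q update_output s2 (5 + ((17 * n + 8 + 4) + 1)) ?R"
            unfolding update_output_def
          proof (rule runs_Cond)
            assume "\<not> bval (RLess (RGet ''ow'' (NConst 0)) (RGet ''bw'' (NConst 0))) s2"
            then have "sum v X \<le> reals s ''ow'' 0" using s2 by simp
            then have "sum v Y \<le> reals s ''ow'' 0" if "Q Y" "card Y \<le> Suc k" for Y
              using that max[of Y] inv' by (cases "card Y = Suc k") auto
            then have "?R s2"
              using inv' s2 opt by (auto simp: greedy_inv_def search_inv_def array_set_nset)
            then show "runs Q Skip s2 1 ?R" by (rule runs_Skip)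
          next
            assume "bval (RLess (RGet ''ow'' (NConst 0)) (RGet ''bw'' (NConst 0))) s2"
            then have less: "reals s ''ow'' 0 < sum v X" using s2 by simp
            show "runs Q (Seq (copy_array ''out'' ''best'')
               (RSet ''ow'' (NConst 0) (RGet ''bw'' (NConst 0)))) s2 (17 * n + 8 + 4) ?R"
            proof (rule runs_Seq, rule runs_mono[OF runs_copy_array[where n = n] order_refl])
              fix s3 assume 3: "agree_off {''i'', ''out''} {} s2 s3 \<and>
                array_set s3 ''out'' = array_set s2 ''best''"
              have s3: "search_inv n s3" "nats s3 ''k'' 0 = k" "reals s3 ''w'' = v"
                "array_set s3 ''out'' = X" "reals s3 ''bw'' 0 = sum v X" "array_set s3 ''cur'' = X"
                using 3 s2 by (auto simp: agree_off_def search_inv_def array_set_def)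
              have "sum v Y \<le> sum v X" if "Q Y" "card Y \<le> Suc k" for Y
                using that max[of Y] inv' less by (cases "card Y = Suc k") fastforce+
              moreover have "X \<subseteq> {..<n}" using si by (simp add: search_inv_def X_def)
              ultimately have "?R (rset ''ow'' 0 (reals s3 ''bw'' 0) s3)"
                using s3 opt X by (auto simp: greedy_inv_def search_inv_def array_set_nset)
              then show "runs Q (RSet ''ow'' (NConst 0) (RGet ''bw'' (NConst 0))) s3 4 ?R"
                by (intro runs_RSet) auto
            qed (use s2 inv' in \<open>auto simp: search_inv_def\<close>)
          qed auto
        qed (use si in \<open>auto simp: search_inv_def\<close>)
      qed auto
    qed
  qed auto
  then show ?thesis by (rule runs_mono) auto
qed

definition greedy :: com where
  "greedy = for_loop ''k'' greedy_step"

lemma runs_greedy: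
  assumes ground: "\<And>X. Q X \<Longrightarrow> X \<subseteq> {..<n}" and empty: "Q {}"
    and down: "\<And>X Y. Q Y \<Longrightarrow> X \<subseteq> Y \<Longrightarrow> Q X"
    and augment: "\<And>k I J. opt_of_card Q v k I \<Longrightarrow> Q J \<Longrightarrow> card J = Suc k \<Longrightarrow>
      \<exists>a<n. \<exists>b<n. \<exists>f<n. Q (exchange I a b f) \<and> card (exchange I a b f) = Suc k \<and>
        sum v J \<le> sum v (exchange I a b f)"
    and v: "\<And>i. i \<ge> n \<Longrightarrow> v i = 0"
  shows "runs Q greedy (input_state n v)
    (n * (n * (n * (n * (100 * n + 111) + 19) + 19) + 100 * n + 100 + 11) + 8)
    (\<lambda>s. Q (output_set s) \<and> (\<forall>Y. Q Y \<longrightarrow> sum v Y \<le> sum v (output_set s)))"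
proof -
  \<comment> \<open>\<open>card\<close> is 0 on infinite sets too; the bound \<open>{..<n}\<close>
    rules these out.\<close>
  have card0: "card Y = 0 \<longleftrightarrow> Y = {}" if "Q Y" for Y
    using ground[OF that] finite_subset by fastforce
  have w: "reals (input_state n v) ''w'' = v" using v by (auto simp: input_state_def)
  have "runs Q greedy (input_state n v)
      (n * (n * (n * (n * (100 * n + 111) + 19) + 19) + 100 * n + 100 + 11) + 8) (greedy_inv Q v n n)"
    unfolding greedy_def
  proof (rule runs_for_loop[where Inv = "greedy_inv Q v n"])
    \<comment> \<open>The zero-initialized memory represents the empty set, of weight 0, in both
      \<open>cur\<close> and \<open>out\<close>.\<close>
    show "greedy_inv Q v n 0 (nset ''k'' 0 0 (input_state n v))"
      using w empty card0
      by (auto simp: greedy_inv_def search_inv_def opt_of_card_def array_set_def input_state_def)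
    show "nats s ''n'' 0 = n \<and> nats s ''k'' 0 = k" if "greedy_inv Q v n k s" for k s
      using that by (auto simp: greedy_inv_def search_inv_def)
  qed (rule runs_greedy_step[OF down augment])
  then show ?thesis
  proof (rule runs_mono[OF _ order_refl])
    fix s assume inv: "greedy_inv Q v n n s"
    have "card Y \<le> n" if "Q Y" for Y using card_mono[OF _ ground[OF that]] by simp
    then show "Q (output_set s) \<and> (\<forall>Y. Q Y \<longrightarrow> sum v Y \<le> sum v (output_set s))"
      using inv by (auto simp: greedy_inv_def output_set_def)
  qed
qed

section \<open>Transport between positions and ground set elements\<close>

theorem theorem1p3:
  "\<exists>(c :: com) (p :: nat poly).
     \<forall>(E :: 'a set) (\<I>1 :: 'a set set) (\<I>2 :: 'a set set) (e :: nat \<Rightarrow> 'a) (w :: 'a \<Rightarrow> real) (n :: nat).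
       elementary_split_matroid E \<I>1 \<and> loopless E \<I>1 \<and>
       matroid E \<I>2 \<and> loopless E \<I>2 \<and>
       n = card E \<and> bij_betw e {..<n} E \<longrightarrow>
       (\<exists>t s. exec (common_indep_oracle n e \<I>1 \<I>2) c (input_state n (\<lambda>i. w (e i))) t s \<and>
              t \<le> poly p n \<and>
              output_set s \<subseteq> {..<n} \<and>
              max_weight_common_indep \<I>1 \<I>2 w (e ` output_set s))"
proof (rule exI[of _ greedy], rule exI[of _ "[:0, 1:] * ([:0, 1:] * ([:0, 1:] * ([:0, 1:] * [:111, 100:] + [:19:]) + [:19:]) +
    [:111, 100:]) + [:8:]"], intro allI impI)
  fix E :: "'a set" and \<I>1 \<I>2 :: "'a set set" and e :: "nat \<Rightarrow> 'a" and w :: "'a \<Rightarrow> real" and n :: nat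
  assume asm: "elementary_split_matroid E \<I>1 \<and> loopless E \<I>1 \<and>
       matroid E \<I>2 \<and> loopless E \<I>2 \<and> n = card E \<and> bij_betw e {..<n} E"
  then have split: "elementary_split_matroid E \<I>1" and e: "bij_betw e {..<n} E" by auto
  interpret M1: matroid E \<I>1 using split unfolding elementary_split_matroid_def by blast
  interpret M2: matroid E \<I>2 using asm by blast
  \<comment> \<open>The running-time bound in Horner-like form, of degree 5 in \<open>n\<close>:
    \<open>[:0, 1:]\<close> is the variable and \<open>[:111, 100:]\<close> is
    \<open>100 * n + 111\<close>.\<close>
  let ?p = "[:0, 1:] * ([:0, 1:] * ([:0, 1:] * ([:0, 1:] * [:111, 100:] + [:19:]) + [:19:]) +
    [:111, 100:]) + [:8:] :: nat poly"
  define Q where "Q = common_indep_oracle n e \<I>1 \<I>2"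
  \<comment> \<open>Zero padding makes \<open>v\<close> equal to the whole array \<open>w\<close> of
    the initial memory.\<close>
  define v where "v i = (if i < n then w (e i) else 0)" for i
  have inj: "inj_on e {..<n}" and img: "e ` {..<n} = E" using e unfolding bij_betw_def by auto
  have Q: "Q S \<longleftrightarrow> S \<subseteq> {..<n} \<and> e ` S \<in> \<I>1 \<inter> \<I>2" for S
    by (simp add: Q_def common_indep_oracle_def)
  have card_e: "card (e ` S) = card S" if "S \<subseteq> {..<n}" for S
    using inj_on_subset[OF inj that] by (rule card_image)
  have sum_e: "sum v S = sum w (e ` S)" if "S \<subseteq> {..<n}" for S
  proof -
    have "sum v S = (\<Sum>i\<in>S. w (e i))" using that by (intro sum.cong) (auto simp: v_def)
    also have "\<dots> = sum w (e ` S)" using inj_on_subset[OF inj that] by (simp add: sum.reindex)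
    finally show ?thesis .
  qed
  have preimage: "\<exists>S \<subseteq> {..<n}. e ` S = Y" if "Y \<in> \<I>1" for Y
    using M1.indep_subset_ground[OF that] img by (metis subset_imageE)
  have state: "input_state n (\<lambda>i. w (e i)) = input_state n v"
    by (simp add: input_state_def v_def fun_eq_iff)
  have "runs Q greedy (input_state n v)
    (n * (n * (n * (n * (100 * n + 111) + 19) + 19) + 100 * n + 100 + 11) + 8)
    (\<lambda>s. Q (output_set s) \<and> (\<forall>Y. Q Y \<longrightarrow> sum v Y \<le> sum v (output_set s)))"
  proof (rule runs_greedy)
    show "X \<subseteq> {..<n}" if "Q X" for X using that Q by blast
    show "Q {}" using Q M1.indep_empty M2.indep_empty by simp
    show "Q X" if "Q Y" "X \<subseteq> Y" for X Y
    proof -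
      have "e ` X \<subseteq> e ` Y" using that(2) by (rule image_mono)
      then show ?thesis using that Q M1.indep_subset M2.indep_subset by (meson Int_iff subset_trans)
    qed
    show "v i = 0" if "i \<ge> n" for i using that by (simp add: v_def)
    fix k I J
    assume I: "opt_of_card Q v k I" and J: "Q J" "card J = Suc k"
    have QI: "Q I" "card I = k" and I_max: "\<And>Y. Q Y \<Longrightarrow> card Y = k \<Longrightarrow> sum v Y \<le> sum v I"
      using I by (auto simp: opt_of_card_def)
    have sub: "I \<subseteq> {..<n}" "J \<subseteq> {..<n}" using QI J Q by auto
    have "\<exists>a \<in> E. \<exists>b \<in> E. \<exists>f \<in> E. (e ` I - {f}) \<union> {a, b} \<in> \<I>1 \<inter> \<I>2 \<and>
      card ((e ` I - {f}) \<union> {a, b}) = Suc (card (e ` I)) \<and>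
      sum w (e ` J) \<le> sum w ((e ` I - {f}) \<union> {a, b})"
    proof (rule local_augmentation[OF split M2.matroid_axioms])
      show "e ` I \<in> \<I>1 \<inter> \<I>2" "e ` J \<in> \<I>1 \<inter> \<I>2" using QI J Q by auto
      show "card (e ` J) = Suc (card (e ` I))" using QI J sub card_e by simp
      fix X assume X: "X \<in> \<I>1 \<inter> \<I>2" "card X = card (e ` I)"
      then obtain S where S: "S \<subseteq> {..<n}" "e ` S = X" using preimage by blast
      then have "sum v S \<le> sum v I"
        using I_max[of S] X Q QI card_e[of S] card_e[of I] sub by auto
      then show "sum w X \<le> sum w (e ` I)" using sum_e S sub by simp
    qed
    then obtain a b f where abf: "a < n" "b < n" "f < n"
      and aug: "(e ` I - {e f}) \<union> {e a, e b} \<in> \<I>1 \<inter> \<I>2"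
      "card ((e ` I - {e f}) \<union> {e a, e b}) = Suc (card (e ` I))"
      "sum w (e ` J) \<le> sum w ((e ` I - {e f}) \<union> {e a, e b})"
      unfolding img[symmetric] by blast
    have sub': "exchange I a b f \<subseteq> {..<n}" using sub abf by (auto simp: exchange_def)
    \<comment> \<open>Injectivity of \<open>e\<close> on positions lets the image commute with
      deletion.\<close>
    have "e ` (I - {f}) = e ` I - {e f}"
      using inj_on_image_set_diff[OF inj, of I "{f}"] sub abf by auto
    then have eq: "(e ` I - {e f}) \<union> {e a, e b} = e ` exchange I a b f"
      by (simp add: exchange_def image_Un)
    have "Q (exchange I a b f)" "card (exchange I a b f) = Suc k" "sum v J \<le> sum v (exchange I a b f)"
      using aug[unfolded eq] sub sub' Q QI(2) card_e sum_e by auto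
    then show "\<exists>a<n. \<exists>b<n. \<exists>f<n. Q (exchange I a b f) \<and> card (exchange I a b f) = Suc k \<and>
        sum v J \<le> sum v (exchange I a b f)"
      using abf by blast
  qed
  then obtain t s where run: "exec Q greedy (input_state n v) t s"
    and t: "t \<le> n * (n * (n * (n * (100 * n + 111) + 19) + 19) + 100 * n + 100 + 11) + 8"
    and out: "Q (output_set s)" and best: "\<And>Y. Q Y \<Longrightarrow> sum v Y \<le> sum v (output_set s)"
    unfolding runs_def by blast
  have poly_p: "poly ?p n = n * (n * (n * (n * (100 * n + 111) + 19) + 19) + 100 * n + 100 + 11) + 8"
    by (simp add: algebra_simps)
  have "t \<le> poly ?p n" unfolding poly_p by (rule t)
  moreover have "max_weight_common_indep \<I>1 \<I>2 w (e ` output_set s)"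
    unfolding max_weight_common_indep_def
  proof (intro conjI ballI)
    show "e ` output_set s \<in> \<I>1 \<inter> \<I>2" using out Q by blast
    fix Y assume Y: "Y \<in> \<I>1 \<inter> \<I>2"
    then obtain S where S: "S \<subseteq> {..<n}" "e ` S = Y" using preimage by blast
    then have "sum v S \<le> sum v (output_set s)" using best Q Y by blast
    then show "sum w Y \<le> sum w (e ` output_set s)" using S sum_e out Q by simp
  qed
  ultimately show "\<exists>t s. exec (common_indep_oracle n e \<I>1 \<I>2) greedy (input_state n (\<lambda>i. w (e i))) t s \<and>
      t \<le> poly ?p n \<and> output_set s \<subseteq> {..<n} \<and>
      max_weight_common_indep \<I>1 \<I>2 w (e ` output_set s)"
    using run out Q unfolding state Q_def[symmetric] by blast
qed

end
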